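(* Let $n\geq 2$. The Andreadakis equality holds for $hP\Sigma_n$: for every $j\geq 1$, \[\Gamma_j(hP\Sigma_n)=hP\Sigma_n\cap\mathcal A_j(RF_n).\]
   Context: Notation: $x^y=y^{-1}xy$, $[x,y]=xyx^{-1}y^{-1}$, $\Gamma_*$ is the lower central series ($\Gamma_1=G$, $\Gamma_{k+1}=[G,\Gamma_k]$). $RF_n=\langle x_1,\dots,x_n\mid [x_i,x_i^w]=1\ (w\in F_n)\rangle$ is the reduced free group. $hP\Sigma_n$ is the subgroup of $\mathrm{Aut}(RF_n)$ of automorphisms sending each $x_i$ to a conjugate of $x_i$. The Andreadakis filtration is $\mathcal A_j(RF_n)=\{\sigma\in\mathrm{Aut}(RF_n) : \sigma(g)g^{-1}\in\Gamma_{i+j}(RF_n)\ \forall i\geq1,\ \forall g\in\Gamma_i(RF_n)\}$. *)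

theory Defs
  imports "HOL-Algebra.Algebra"
begin

text \<open>A letter is (i, e): e = False means x_i, e = True means x_i^-1.\<close>
type_synonym letter = "nat \<times> bool"
type_synonym word = "letter list"

definition letters :: "nat \<Rightarrow> letter set" where
  "letters n = {l. fst l < n}"

definition words :: "nat \<Rightarrow> word set" where
  "words n = lists (letters n)"

definition winv :: "word \<Rightarrow> word" where
  "winv w = rev (map (\<lambda>(i, e). (i, \<not> e)) w)"

definition wconj :: "word \<Rightarrow> word \<Rightarrow> word" where
  "wconj x y = winv y @ x @ y"

definition wcomm :: "word \<Rightarrow> word \<Rightarrow> word" where
  "wcomm x y = x @ y @ winv x @ winv y"

definition rf_relators :: "nat \<Rightarrow> word set" where
  "rf_relators n = {wcomm [(i, False)] (wconj [(i, False)] w) | i w. i < n \<and> w \<in> words n}"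

inductive rf_eq :: "nat \<Rightarrow> word \<Rightarrow> word \<Rightarrow> bool" for n where
  refl: "rf_eq n w w"
| sym: "rf_eq n u v \<Longrightarrow> rf_eq n v u"
| trans: "rf_eq n u v \<Longrightarrow> rf_eq n v w \<Longrightarrow> rf_eq n u w"
| ctx: "rf_eq n u v \<Longrightarrow> rf_eq n (a @ u @ b) (a @ v @ b)"
| cancel: "rf_eq n [(i, e), (i, \<not> e)] []"
| rel: "r \<in> rf_relators n \<Longrightarrow> rf_eq n r []"

definition rf_class :: "nat \<Rightarrow> word \<Rightarrow> word set" where
  "rf_class n w = {v \<in> words n. rf_eq n w v}"

definition RF :: "nat \<Rightarrow> word set monoid" where
  "RF n = \<lparr> carrier = rf_class n ` words n,
            monoid.mult = (\<lambda>A B. rf_class n ((SOME a. a \<in> A) @ (SOME b. b \<in> B))),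
            monoid.one = rf_class n [] \<rparr>"

definition gen :: "nat \<Rightarrow> nat \<Rightarrow> word set" where
  "gen n i = rf_class n [(i, False)]"

definition gcomm :: "('a, 'b) monoid_scheme \<Rightarrow> 'a \<Rightarrow> 'a \<Rightarrow> 'a" where
  "gcomm G x y = x \<otimes>\<^bsub>G\<^esub> y \<otimes>\<^bsub>G\<^esub> inv\<^bsub>G\<^esub> x \<otimes>\<^bsub>G\<^esub> inv\<^bsub>G\<^esub> y"

text \<open>Gamma_1 = G, Gamma_(k+1) = [G, Gamma_k]; Gamma_0 is set to G by convention (unused).\<close>
fun lcs :: "('a, 'b) monoid_scheme \<Rightarrow> nat \<Rightarrow> 'a set" where
  "lcs G 0 = carrier G"
| "lcs G (Suc 0) = carrier G"
| "lcs G (Suc (Suc k)) =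
     generate G {gcomm G x y | x y. x \<in> carrier G \<and> y \<in> lcs G (Suc k)}"

definition AutRF :: "nat \<Rightarrow> (word set \<Rightarrow> word set) monoid" where
  "AutRF n = AutoGroup (RF n)"

definition hPSigma :: "nat \<Rightarrow> (word set \<Rightarrow> word set) set" where
  "hPSigma n = {\<sigma> \<in> auto (RF n). \<forall>i < n. \<exists>g \<in> carrier (RF n).
      \<sigma> (gen n i) = inv\<^bsub>RF n\<^esub> g \<otimes>\<^bsub>RF n\<^esub> gen n i \<otimes>\<^bsub>RF n\<^esub> g}"

definition hPSigma_grp :: "nat \<Rightarrow> (word set \<Rightarrow> word set) monoid" where
  "hPSigma_grp n = (AutRF n)\<lparr>carrier := hPSigma n\<rparr>"

definition andreadakis :: "nat \<Rightarrow> nat \<Rightarrow> (word set \<Rightarrow> word set) set" where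
  "andreadakis n j = {\<sigma> \<in> auto (RF n). \<forall>i \<ge> 1. \<forall>g \<in> lcs (RF n) i.
      \<sigma> g \<otimes>\<^bsub>RF n\<^esub> inv\<^bsub>RF n\<^esub> g \<in> lcs (RF n) (i + j)}"

end

theory Submission
  imports Defs
begin

text \<open>
  The Magnus expansion \<open>x_i \<mapsto> 1 + X_i\<close> sends the reduced free group to the units of the ring of
  integral noncommutative polynomials modulo the monomials in which some variable occurs twice.
  Write \<open>c(m, i_1 \<dots> i_k) = [x_(i_1), [\<dots>, [x_(i_k), x_m]]]\<close>. Peeling off the last generator, every
  element is a product of an element of the abelian normal subgroup generated by the \<open>c(m, I)\<close> with
  \<open>I\<close> a word in the letters below \<open>m\<close>, and an element involving only smaller generators; the exponent
  of \<open>c(m, I)\<close> is the coefficient of \<open>X_I X_m\<close> in the Magnus expansion. Hence \<open>\<Gamma>_k\<close> consists of the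
  elements whose expansion is 1 up to terms of degree at least \<open>k\<close>, and \<open>\<Gamma>_(n+1)\<close> is trivial.

  The inclusion \<open>\<Gamma>_j(hP\<Sigma>_n) \<subseteq> \<A>_j\<close> follows from \<open>hP\<Sigma>_n \<subseteq> \<A>_1\<close> and \<open>[\<A>_1, \<A>_j] \<subseteq> \<A>_(j+1)\<close>. For
  the converse, let \<open>\<sigma>\<close> be in \<open>hP\<Sigma>_n \<inter> \<A>_j\<close>. Then
  \<open>\<sigma>(x_i) = w_i\<inverse> x_i w_i\<close> where \<open>w_i\<close> may be chosen in
  the subgroup generated by the other generators, and the Magnus expansion shows that \<open>w_i\<close> lies in
  \<open>\<Gamma>_j\<close>. For fixed \<open>i\<close>, sending \<open>w\<close> in that subgroup to the automorphism that maps \<open>x_i\<close> to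
  \<open>w\<inverse> x_i w\<close> and fixes the other generators is a homomorphism, so it maps \<open>\<Gamma>_j\<close> into
  \<open>\<Gamma>_j(hP\<Sigma>_n)\<close>. Dividing \<open>\<sigma>\<close> by these automorphisms for \<open>w_0, \<dots>, w_(n-1)\<close> moves it into
  \<open>\<A>_(j+1)\<close>, and descending induction on \<open>j\<close> concludes.
\<close>

section \<open>The reduced Magnus ring\<close>

text \<open>Sum of \<open>f u * g v\<close> over all splittings of the word into u followed by v.
  Each letter passed is absorbed into the argument of \<open>f\<close>, which makes the convolution
  structurally recursive.\<close>

fun mconv :: "(nat list \<Rightarrow> int) \<Rightarrow> (nat list \<Rightarrow> int) \<Rightarrow> nat list \<Rightarrow> int" where
  "mconv f g [] = f [] * g []"
| "mconv f g (a # l) = f [] * g (a # l) + mconv (\<lambda>k. f (a # k)) g l"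

lemma mconv_cong:
  "(\<And>u v. l = u @ v \<Longrightarrow> f u = f' u \<and> g v = g' v) \<Longrightarrow> mconv f g l = mconv f' g' l"
proof (induction l arbitrary: f f')
  case (Cons a l)
  have "f [] = f' [] \<and> g (a # l) = g' (a # l)" using Cons.prems[of "[]"] by simp
  moreover have "mconv (\<lambda>k. f (a # k)) g l = mconv (\<lambda>k. f' (a # k)) g' l"
    by (rule Cons.IH) (metis Cons.prems append_Cons)
  ultimately show ?case by simp
qed simp

lemma mconv_eq_0: "(\<And>u v. l = u @ v \<Longrightarrow> f u * g v = 0) \<Longrightarrow> mconv f g l = 0"
proof (induction l arbitrary: f)
  case (Cons a l)
  have "mconv (\<lambda>k. f (a # k)) g l = 0"
    by (rule Cons.IH) (metis Cons.prems append_Cons)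
  then show ?case using Cons.prems[of "[]"] by simp
qed simp

lemma mconv_add_left: "mconv (\<lambda>l. f l + f' l) g l = mconv f g l + mconv f' g l"
  by (induction l arbitrary: f f') (simp_all add: algebra_simps)

lemma mconv_add_right: "mconv f (\<lambda>l. g l + g' l) l = mconv f g l + mconv f g' l"
  by (induction l arbitrary: f) (simp_all add: algebra_simps)

lemma mconv_scale_left: "mconv (\<lambda>l. c * f l) g l = c * mconv f g l"
  by (induction l arbitrary: f) (simp_all add: algebra_simps)

text \<open>After one letter the left factor is a multiple of a shift of \<open>g\<close> plus a
  convolution of the same kind, so linearity in the first argument closes the induction.\<close>

lemma mconv_assoc: "mconv (mconv f g) h l = mconv f (mconv g h) l"
  by (induction l arbitrary: f)
    (simp_all add: algebra_simps mconv_add_left mconv_scale_left)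

lemma mconv_one_left: "mconv (\<lambda>l. of_bool (l = [])) g l = g l"
  by (cases l) (simp_all add: mconv_eq_0)

lemma mconv_one_right: "mconv f (\<lambda>l. of_bool (l = [])) l = f l"
  by (induction l arbitrary: f) simp_all

lemma mconv_var_left: "mconv (\<lambda>l. of_bool (l = [i])) g (a # l) = of_bool (a = i) * g l"
  by (cases "a = i") (simp_all add: mconv_one_left mconv_eq_0)

lemma mconv_var_right: "mconv f (\<lambda>l. of_bool (l = [i])) (l @ [a]) = of_bool (a = i) * f l"
  by (induction l arbitrary: f) simp_all

text \<open>
  Monomials are words of variable indices; the monomials that are not multilinear are killed, so a
  ring element is a coefficient function vanishing on the non-distinct words.
\<close>

typedef magnus = "{f :: nat list \<Rightarrow> int. \<forall>l. \<not> distinct l \<longrightarrow> f l = 0}"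
  morphisms mcoeff Abs_magnus
  by (rule exI[of _ "\<lambda>_. 0"]) simp

setup_lifting type_definition_magnus

lemma mcoeff_not_distinct [simp]: "\<not> distinct l \<Longrightarrow> mcoeff f l = 0"
  using mcoeff[of f] by simp

instantiation magnus :: ring_1
begin

lift_definition zero_magnus :: magnus is "\<lambda>_. 0" by simp
lift_definition one_magnus :: magnus is "\<lambda>l. of_bool (l = [])" by auto
lift_definition plus_magnus :: "magnus \<Rightarrow> magnus \<Rightarrow> magnus" is "\<lambda>f g l. f l + g l" by simp
lift_definition minus_magnus :: "magnus \<Rightarrow> magnus \<Rightarrow> magnus" is "\<lambda>f g l. f l - g l" by simp
lift_definition uminus_magnus :: "magnus \<Rightarrow> magnus" is "\<lambda>f l. - f l" by simp
lift_definition times_magnus :: "magnus \<Rightarrow> magnus \<Rightarrow> magnus" is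
  "\<lambda>f g l. of_bool (distinct l) * mconv f g l" by simp

text \<open>Factors of a repetition-free word are repetition-free: the discarded monomials form a
  two-sided ideal, so truncating a factor first leaves the truncated product unchanged.\<close>

lemma mconv_of_bool_distinct_left:
  "distinct l \<Longrightarrow> mconv (\<lambda>k. of_bool (distinct k) * f k) g l = mconv f g l"
  by (rule mconv_cong) auto

lemma mconv_of_bool_distinct_right:
  "distinct l \<Longrightarrow> mconv f (\<lambda>k. of_bool (distinct k) * g k) l = mconv f g l"
  by (rule mconv_cong) auto

instance
proof
  fix a b c :: magnus
  show "a + b + c = a + (b + c)" by transfer (simp add: algebra_simps)
  show "a + b = b + a" by transfer (simp add: algebra_simps)
  show "0 + a = a" by transfer simp
  show "- a + a = 0" by transfer simp
  show "a - b = a + - b" by transfer simp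
  show "a * b * c = a * (b * c)"
    by transfer (auto simp: fun_eq_iff mconv_of_bool_distinct_left mconv_of_bool_distinct_right mconv_assoc)
  show "1 * a = a" by transfer (auto simp: fun_eq_iff mconv_one_left)
  show "a * 1 = a" by transfer (auto simp: fun_eq_iff mconv_one_right)
  show "(a + b) * c = a * c + b * c"
    by transfer (auto simp: fun_eq_iff mconv_add_left)
  show "a * (b + c) = a * b + a * c"
    by transfer (auto simp: fun_eq_iff mconv_add_right)
  show "(0::magnus) \<noteq> 1" by transfer (auto simp: fun_eq_iff)
qed

end

lift_definition mvar :: "nat \<Rightarrow> magnus" is "\<lambda>i l. of_bool (l = [i])" by auto

lemma mcoeff_simps [simp]:
  "mcoeff 0 l = 0" "mcoeff 1 l = of_bool (l = [])" "mcoeff (f + g) l = mcoeff f l + mcoeff g l"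
  "mcoeff (f - g) l = mcoeff f l - mcoeff g l" "mcoeff (- f) l = - mcoeff f l"
  "mcoeff (mvar i) l = of_bool (l = [i])"
  by (simp_all add: zero_magnus.rep_eq one_magnus.rep_eq plus_magnus.rep_eq minus_magnus.rep_eq
      uminus_magnus.rep_eq mvar.rep_eq)

lemma magnus_eqI: "(\<And>l. distinct l \<Longrightarrow> mcoeff f l = mcoeff g l) \<Longrightarrow> f = g"
  by (subst mcoeff_inject[symmetric], rule ext) (metis mcoeff_not_distinct)

lemma mcoeff_mult: "distinct l \<Longrightarrow> mcoeff (f * g) l = mconv (mcoeff f) (mcoeff g) l"
  by (simp add: times_magnus.rep_eq)

lemma mcoeff_mult_eq_0:
  "(\<And>u v. l = u @ v \<Longrightarrow> distinct l \<Longrightarrow> mcoeff f u * mcoeff g v = 0) \<Longrightarrow> mcoeff (f * g) l = 0"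
  by (metis mcoeff_mult mcoeff_not_distinct mconv_eq_0)

lemma mcoeff_mvar: "mcoeff (mvar i) = (\<lambda>l. of_bool (l = [i]))"
  by (simp add: fun_eq_iff)

lemma mcoeff_mvar_mult:
  "distinct (a # l) \<Longrightarrow> mcoeff (mvar i * f) (a # l) = of_bool (a = i) * mcoeff f l"
  by (simp only: mcoeff_mult mcoeff_mvar mconv_var_left)

lemma mcoeff_mult_mvar:
  "distinct (l @ [a]) \<Longrightarrow> mcoeff (f * mvar i) (l @ [a]) = of_bool (a = i) * mcoeff f l"
  by (simp only: mcoeff_mult mcoeff_mvar mconv_var_right)

section \<open>Degree filtration, the ideal of a variable, subrings on fewer variables\<close>

definition deg_ge :: "nat \<Rightarrow> magnus set" where
  "deg_ge d = {f. \<forall>l. length l < d \<longrightarrow> mcoeff f l = 0}"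

definition with_var :: "nat \<Rightarrow> magnus set" where
  "with_var m = {f. \<forall>l. m \<notin> set l \<longrightarrow> mcoeff f l = 0}"

definition over_vars :: "nat set \<Rightarrow> magnus set" where
  "over_vars S = {f. \<forall>l. \<not> set l \<subseteq> S \<longrightarrow> mcoeff f l = 0}"

lemma deg_ge_add: "f \<in> deg_ge d \<Longrightarrow> g \<in> deg_ge d \<Longrightarrow> f + g \<in> deg_ge d"
  and deg_ge_diff: "f \<in> deg_ge d \<Longrightarrow> g \<in> deg_ge d \<Longrightarrow> f - g \<in> deg_ge d"
  and deg_ge_uminus: "f \<in> deg_ge d \<Longrightarrow> - f \<in> deg_ge d"
  and deg_ge_zero: "0 \<in> deg_ge d"
  and deg_ge_0: "f \<in> deg_ge 0"
  by (auto simp: deg_ge_def)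

lemma deg_ge_mult: "f \<in> deg_ge d \<Longrightarrow> g \<in> deg_ge e \<Longrightarrow> f * g \<in> deg_ge (d + e)"
proof -
  assume f: "f \<in> deg_ge d" and g: "g \<in> deg_ge e"
  have "mcoeff (f * g) l = 0" if "length l < d + e" for l
  proof (rule mcoeff_mult_eq_0)
    fix u v assume "l = u @ v"
    with that have "length u < d \<or> length v < e" by auto
    with f g show "mcoeff f u * mcoeff g v = 0" by (auto simp: deg_ge_def)
  qed
  then show ?thesis by (simp add: deg_ge_def)
qed

lemma deg_ge_bracket: "f \<in> deg_ge d \<Longrightarrow> g \<in> deg_ge e \<Longrightarrow> f * g - g * f \<in> deg_ge (d + e)"
  using deg_ge_mult[of f d g e] deg_ge_mult[of g e f d] by (simp add: deg_ge_diff add.commute)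

lemma deg_ge_mult_left: "g \<in> deg_ge d \<Longrightarrow> f * g \<in> deg_ge d"
  and deg_ge_mult_right: "f \<in> deg_ge d \<Longrightarrow> f * g \<in> deg_ge d"
  using deg_ge_mult[of f 0 g d] deg_ge_mult[of f d g 0] by (auto simp: deg_ge_0)

lemma deg_ge_antimono: "d \<le> e \<Longrightarrow> f \<in> deg_ge e \<Longrightarrow> f \<in> deg_ge d"
  by (auto simp: deg_ge_def)

lemma mvar_deg_ge: "mvar i \<in> deg_ge 1"
  by (auto simp: deg_ge_def)

lemma with_var_add: "f \<in> with_var m \<Longrightarrow> g \<in> with_var m \<Longrightarrow> f + g \<in> with_var m"
  and with_var_diff: "f \<in> with_var m \<Longrightarrow> g \<in> with_var m \<Longrightarrow> f - g \<in> with_var m"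
  and with_var_uminus: "f \<in> with_var m \<Longrightarrow> - f \<in> with_var m"
  and mvar_with_var: "mvar m \<in> with_var m"
  by (auto simp: with_var_def)

lemma with_var_mult_left:
  assumes "g \<in> with_var m"
  shows "f * g \<in> with_var m"
proof -
  have "mcoeff (f * g) l = 0" if "m \<notin> set l" for l
  proof (rule mcoeff_mult_eq_0)
    fix u v assume "l = u @ v"
    with that assms show "mcoeff f u * mcoeff g v = 0" by (simp add: with_var_def)
  qed
  then show ?thesis by (simp add: with_var_def)
qed

lemma with_var_mult_right:
  assumes "f \<in> with_var m"
  shows "f * g \<in> with_var m"
proof -
  have "mcoeff (f * g) l = 0" if "m \<notin> set l" for l
  proof (rule mcoeff_mult_eq_0)
    fix u v assume "l = u @ v"
    with that assms show "mcoeff f u * mcoeff g v = 0" by (simp add: with_var_def)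
  qed
  then show ?thesis by (simp add: with_var_def)
qed

text \<open>Every monomial of the product would contain X_m twice. This is the ring counterpart of
  the defining relations, and it kills the error terms in the expansions below.\<close>

lemma with_var_mult_with_var:
  assumes f: "f \<in> with_var m" and g: "g \<in> with_var m"
  shows "f * g = 0"
proof (rule magnus_eqI)
  fix l :: "nat list" assume "distinct l"
  have "mcoeff (f * g) l = 0"
  proof (rule mcoeff_mult_eq_0)
    fix u v assume "l = u @ v"
    with \<open>distinct l\<close> have "m \<notin> set u \<or> m \<notin> set v" by auto
    with f g show "mcoeff f u * mcoeff g v = 0" by (auto simp: with_var_def)
  qed
  then show "mcoeff (f * g) l = mcoeff 0 l" by simp
qed

lemma mvar_mult_mvar: "mvar i * f * mvar i = 0"
  by (intro with_var_mult_with_var[of _ i] with_var_mult_right mvar_with_var)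

lemma mvar_square: "mvar i * mvar i = 0"
  by (intro with_var_mult_with_var[of _ i] mvar_with_var)

lemma over_vars_one: "1 \<in> over_vars S"
  and over_vars_add: "f \<in> over_vars S \<Longrightarrow> g \<in> over_vars S \<Longrightarrow> f + g \<in> over_vars S"
  and over_vars_diff: "f \<in> over_vars S \<Longrightarrow> g \<in> over_vars S \<Longrightarrow> f - g \<in> over_vars S"
  and mvar_over_vars: "i \<in> S \<Longrightarrow> mvar i \<in> over_vars S"
  by (auto simp: over_vars_def)

lemma over_vars_mult:
  assumes f: "f \<in> over_vars S" and g: "g \<in> over_vars S"
  shows "f * g \<in> over_vars S"
proof -
  have "mcoeff (f * g) l = 0" if "\<not> set l \<subseteq> S" for l
  proof (rule mcoeff_mult_eq_0)
    fix u v assume "l = u @ v"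
    with that have "\<not> set u \<subseteq> S \<or> \<not> set v \<subseteq> S" by auto
    with f g show "mcoeff f u * mcoeff g v = 0" by (auto simp: over_vars_def)
  qed
  then show ?thesis by (simp add: over_vars_def)
qed

section \<open>Generated subgroups and lower central series\<close>

lemma (in group) inv_cancel [simp]:
  assumes "a \<in> carrier G" "b \<in> carrier G"
  shows "inv a \<otimes> (a \<otimes> b) = b" "a \<otimes> (inv a \<otimes> b) = b"
  using assms by (simp_all add: m_assoc[symmetric])

lemma (in group) commutes_inv:
  assumes "a \<in> carrier G" "b \<in> carrier G" "a \<otimes> b = b \<otimes> a"
  shows "a \<otimes> inv b = inv b \<otimes> a"
proof -
  have "a \<otimes> inv b = inv b \<otimes> (b \<otimes> a) \<otimes> inv b" using assms(1,2) by (simp add: m_assoc)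
  also have "\<dots> = inv b \<otimes> a" using assms(1,2) by (simp add: assms(3)[symmetric] m_assoc)
  finally show ?thesis .
qed

lemma (in group) gcomm_closed [simp]:
  "a \<in> carrier G \<Longrightarrow> b \<in> carrier G \<Longrightarrow> gcomm G a b \<in> carrier G"
  by (simp add: gcomm_def)

lemma (in group) generate_commute:
  assumes S: "S \<subseteq> carrier G" and y: "y \<in> carrier G"
    and comm: "\<And>s. s \<in> S \<Longrightarrow> s \<otimes> y = y \<otimes> s" and g: "g \<in> generate G S"
  shows "g \<otimes> y = y \<otimes> g"
  using g
proof (induction rule: generate.induct)
  case one
  then show ?case using y by simp
next
  case (incl h)
  then show ?case by (rule comm)
next
  case (inv h)
  then have h: "h \<in> carrier G" using S by auto
  show ?case using commutes_inv[OF y h] comm[OF inv] by simp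
next
  case (eng h1 h2)
  then have "h1 \<in> carrier G" "h2 \<in> carrier G" using generate_in_carrier[OF S] by auto
  then show ?case using eng y by (metis m_assoc)
qed

lemma (in group) generate_commutative:
  assumes S: "S \<subseteq> carrier G" and comm: "\<And>s t. s \<in> S \<Longrightarrow> t \<in> S \<Longrightarrow> s \<otimes> t = t \<otimes> s"
    and "g \<in> generate G S" "h \<in> generate G S"
  shows "g \<otimes> h = h \<otimes> g"
proof -
  have "t \<otimes> g = g \<otimes> t" if "t \<in> S" for t
    using generate_commute[OF S _ _ assms(3), of t] comm that S by auto
  then show ?thesis
    using generate_commute[OF S _ _ assms(4), of g] generate_in_carrier[OF S assms(3)] by auto
qed

text \<open>Conjugation by a fixed element is multiplicative, so it is checked on \<open>T\<close>
  first; then \<open>v\<close> is built up from \<open>S\<close>. Inverses of elements of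
  \<open>S\<close> need their own hypothesis: s T s^-1 inside the span of T need not give s^-1 T s
  inside it.\<close>

lemma (in group) generate_conj_closed:
  assumes S: "S \<subseteq> carrier G" and T: "T \<subseteq> carrier G"
    and conj: "\<And>s t. s \<in> S \<Longrightarrow> t \<in> T \<Longrightarrow> s \<otimes> t \<otimes> inv s \<in> generate G T"
    and conj': "\<And>s t. s \<in> S \<Longrightarrow> t \<in> T \<Longrightarrow> inv s \<otimes> t \<otimes> s \<in> generate G T"
    and v: "v \<in> generate G S" and a: "a \<in> generate G T"
  shows "v \<otimes> a \<otimes> inv v \<in> generate G T"
proof -
  have hom: "v \<otimes> a \<otimes> inv v \<in> generate G T"
    if v: "v \<in> carrier G" and c: "\<And>t. t \<in> T \<Longrightarrow> v \<otimes> t \<otimes> inv v \<in> generate G T"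
      and a: "a \<in> generate G T" for v a
    using a
  proof (induction rule: generate.induct)
    case one
    then show ?case using v by (simp add: generate.one)
  next
    case (incl h)
    then show ?case by (rule c)
  next
    case (inv h)
    then have "v \<otimes> inv h \<otimes> inv v = inv (v \<otimes> h \<otimes> inv v)"
      using v T by (auto simp: inv_mult_group m_assoc subset_iff)
    then show ?case using generate_m_inv_closed[OF T c[OF inv]] by simp
  next
    case (eng h1 h2)
    then have "h1 \<in> carrier G" "h2 \<in> carrier G" using generate_in_carrier[OF T] by auto
    then have "v \<otimes> (h1 \<otimes> h2) \<otimes> inv v = (v \<otimes> h1 \<otimes> inv v) \<otimes> (v \<otimes> h2 \<otimes> inv v)"
      using v by (simp add: m_assoc)
    then show ?case using eng generate.eng by metis
  qed
  show ?thesis using v a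
  proof (induction arbitrary: a rule: generate.induct)
    case one
    then show ?case using generate_in_carrier[OF T one(1)] by simp
  next
    case (incl h)
    show ?case by (rule hom[OF _ conj[OF incl(1)] incl(2)]) (use incl S in auto)
  next
    case (inv h)
    then have h: "h \<in> carrier G" using S by auto
    show ?case by (rule hom) (use h inv conj' in simp_all)
  next
    case (eng h1 h2)
    then have "h1 \<in> carrier G" "h2 \<in> carrier G" using generate_in_carrier[OF S] by auto
    moreover have "a \<in> carrier G" using eng(5) generate_in_carrier[OF T] by auto
    ultimately have "h1 \<otimes> h2 \<otimes> a \<otimes> inv (h1 \<otimes> h2) = h1 \<otimes> (h2 \<otimes> a \<otimes> inv h2) \<otimes> inv h1"
      by (simp add: m_assoc inv_mult_group)
    then show ?case using eng by simp
  qed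
qed

text \<open>\<open>finprod\<close> requires a commutative structure, so products are formed in
  \<open>subgroup_generated G S\<close>; this transfers membership to a subgroup \<open>Q\<close> of
  the ambient group.\<close>

lemma (in group) finprod_subgroup_generated_mem:
  assumes "comm_group (subgroup_generated G S)" "subgroup Q G"
    and "\<And>i. i \<in> I \<Longrightarrow> f i \<in> carrier (subgroup_generated G S)" "\<And>i. i \<in> I \<Longrightarrow> f i \<in> Q"
  shows "finprod (subgroup_generated G S) f I \<in> Q"
proof -
  interpret A: comm_group "subgroup_generated G S" by fact
  interpret Q: subgroup Q G by fact
  show ?thesis using assms(3,4)
  proof (induction I rule: infinite_finite_induct)
    case (insert a I)
    then have "finprod (subgroup_generated G S) f (insert a I)
      = f a \<otimes> finprod (subgroup_generated G S) f I"
      by (subst A.finprod_insert) auto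
    then show ?case using insert by simp
  qed simp_all
qed

section \<open>The lower central series of an arbitrary group\<close>

lemma (in group) lcs_Suc: "1 \<le> k \<Longrightarrow>
  lcs G (Suc k) = generate G {gcomm G a b | a b. a \<in> carrier G \<and> b \<in> lcs G k}"
  by (cases k) auto

lemma (in group) lcs_subset: "lcs G k \<subseteq> carrier G"
proof (induction k)
  case (Suc k)
  show ?case
  proof (cases "k = 0")
    case False
    have "{gcomm G a b | a b. a \<in> carrier G \<and> b \<in> lcs G k} \<subseteq> carrier G" using Suc by auto
    then show ?thesis using False by (simp add: lcs_Suc generate_incl)
  qed simp
qed simp

lemma (in group) lcs_closed: "g \<in> lcs G k \<Longrightarrow> g \<in> carrier G"
  using lcs_subset by auto

lemma (in group) subgroup_lcs: "subgroup (lcs G k) G"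
proof (cases "k \<le> 1")
  case True
  then have "k = 0 \<or> k = 1" by auto
  then show ?thesis by (auto simp: subgroup_self)
next
  case False
  then obtain m where m: "k = Suc m" "1 \<le> m" by (cases k) auto
  have "{gcomm G a b | a b. a \<in> carrier G \<and> b \<in> lcs G m} \<subseteq> carrier G"
    by (auto simp: lcs_closed)
  then show ?thesis using m by (simp add: lcs_Suc generate_is_subgroup)
qed

lemma (in group) gcomm_in_lcs:
  "1 \<le> k \<Longrightarrow> a \<in> carrier G \<Longrightarrow> b \<in> lcs G k \<Longrightarrow> gcomm G a b \<in> lcs G (Suc k)"
  by (auto simp: lcs_Suc intro!: generate.incl)

lemma (in group) lcs_antimono: "lcs G (Suc k) \<subseteq> lcs G k"
proof (induction k)
  case 0
  show ?case by simp
next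
  case (Suc k)
  show ?case
  proof (cases "k = 0")
    case True
    then show ?thesis using lcs_subset[of "Suc (Suc k)"] by simp
  next
    case False
    then show ?thesis
      using Suc by (simp only: lcs_Suc[of "Suc k"] lcs_Suc[of k]) (auto intro!: mono_generate)
  qed
qed

lemma gcomm_hom:
  assumes "group G" "group H" "h \<in> hom G H" "a \<in> carrier G" "b \<in> carrier G"
  shows "h (gcomm G a b) = gcomm H (h a) (h b)"
proof -
  interpret group_hom G H h using assms by (simp add: group_hom_def group_hom_axioms_def)
  show ?thesis using assms by (simp add: gcomm_def)
qed

text \<open>Homomorphisms carry commutators to commutators. Apart from automorphisms of G, this is
  applied to \<open>conj_one i\<close>, a homomorphism from G to a group of automorphisms.\<close>

lemma lcs_hom:
  assumes G: "group G" and H: "group H" and h: "h \<in> hom G H"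
  shows "g \<in> lcs G k \<Longrightarrow> h g \<in> lcs H k"
proof (induction k arbitrary: g)
  interpret group_hom G H h using assms by (simp add: group_hom_def group_hom_axioms_def)
  case 0
  then show ?case by simp
next
  interpret group_hom G H h using assms by (simp add: group_hom_def group_hom_axioms_def)
  case (Suc k)
  show ?case
  proof (cases "k = 0")
    case True
    then show ?thesis using Suc by simp
  next
    case False
    let ?S = "{gcomm G a b | a b. a \<in> carrier G \<and> b \<in> lcs G k}"
    let ?T = "{gcomm H a b | a b. a \<in> carrier H \<and> b \<in> lcs H k}"
    have S: "?S \<subseteq> carrier G" by (auto simp: G.lcs_closed)
    have "h ` ?S \<subseteq> ?T"
    proof (clarify)
      fix a b assume "a \<in> carrier G" "b \<in> lcs G k"
      then have "h (gcomm G a b) = gcomm H (h a) (h b)" "h a \<in> carrier H" "h b \<in> lcs H k"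
        using Suc.IH gcomm_hom[OF assms] by (auto simp: G.lcs_closed)
      then show "\<exists>a' b'. h (gcomm G a b) = gcomm H a' b' \<and> a' \<in> carrier H \<and> b' \<in> lcs H k" by blast
    qed
    then have "h ` generate G ?S \<subseteq> generate H ?T"
      using H.mono_generate unfolding generate_img[OF S, symmetric] by blast
    then show ?thesis using Suc.prems False by (auto simp: G.lcs_Suc H.lcs_Suc)
  qed
qed

section \<open>The lower central series of the reduced free group\<close>

text \<open>Collects what the argument uses of RF_n: generators, relations, a Magnus representation,
  and the universal property for maps from G to itself. The presentation by words is matched against
  it at the end.\<close>

locale reduced_free_group = group G for G (structure) +
  fixes n :: nat and x :: "nat \<Rightarrow> 'a" and M :: "'a \<Rightarrow> magnus"
  assumes x_closed [simp]: "i < n \<Longrightarrow> x i \<in> carrier G"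
    and generate_x: "generate G (x ` {..<n}) = carrier G"
    and x_commutes_conj:
      "i < n \<Longrightarrow> g \<in> carrier G \<Longrightarrow> x i \<otimes> (g \<otimes> x i \<otimes> inv g) = (g \<otimes> x i \<otimes> inv g) \<otimes> x i"
    and M_one [simp]: "M \<one> = 1"
    and M_mult [simp]: "g \<in> carrier G \<Longrightarrow> h \<in> carrier G \<Longrightarrow> M (g \<otimes> h) = M g * M h"
    and M_x [simp]: "i < n \<Longrightarrow> M (x i) = 1 + mvar i"
    and extension: "(\<And>i. i < n \<Longrightarrow> y i \<in> carrier G) \<Longrightarrow>
      (\<And>i g. i < n \<Longrightarrow> g \<in> carrier G \<Longrightarrow>
        y i \<otimes> (g \<otimes> y i \<otimes> inv g) = (g \<otimes> y i \<otimes> inv g) \<otimes> y i) \<Longrightarrow>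
      \<exists>h \<in> hom G G. \<forall>i<n. h (x i) = y i"
begin

section \<open>The Magnus representation and its dimension subgroups\<close>

lemma x_subset: "m \<le> n \<Longrightarrow> x ` {..<m} \<subseteq> carrier G"
  by auto

lemma M_inv_left [simp]: "g \<in> carrier G \<Longrightarrow> M (inv g) * M g = 1"
  by (metis M_mult M_one inv_closed l_inv)

lemma M_inv_right [simp]: "g \<in> carrier G \<Longrightarrow> M g * M (inv g) = 1"
  by (metis M_mult M_one inv_closed r_inv)

lemma M_inv_eqI: "g \<in> carrier G \<Longrightarrow> M g * f = 1 \<Longrightarrow> M (inv g) = f"
  by (metis M_inv_left mult.assoc mult_1_left mult_1_right)

lemma M_inv_x [simp]: "i < n \<Longrightarrow> M (inv (x i)) = 1 - mvar i"
  by (rule M_inv_eqI) (simp_all add: algebra_simps mvar_square)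

lemma generate_x_closed: "S \<subseteq> {..<n} \<Longrightarrow> g \<in> generate G (x ` S) \<Longrightarrow> g \<in> carrier G"
  by (erule generate_in_carrier[rotated]) auto

lemma M_over_vars: "S \<subseteq> {..<n} \<Longrightarrow> g \<in> generate G (x ` S) \<Longrightarrow> M g \<in> over_vars S"
proof (rotate_tac, induction rule: generate.induct)
  case (eng h1 h2)
  then have "h1 \<in> carrier G" "h2 \<in> carrier G"
    using generate_x_closed by auto
  then show ?case using eng by (simp add: over_vars_mult)
qed (auto intro!: over_vars_one over_vars_add over_vars_diff mvar_over_vars)

lemma M_inv_minus: "g \<in> carrier G \<Longrightarrow> h \<in> carrier G \<Longrightarrow>
    M (inv g) - M (inv h) = - (M (inv g) * (M g - M h) * M (inv h))"
  by (simp add: algebra_simps)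

lemma M_inv_minus_one: "g \<in> carrier G \<Longrightarrow> M (inv g) - 1 = - (M (inv g) * (M g - 1))"
  by (simp add: algebra_simps)

lemma M_mult_minus_one: "g \<in> carrier G \<Longrightarrow> h \<in> carrier G \<Longrightarrow>
    M (g \<otimes> h) - 1 = (M g - 1) * M h + (M h - 1)"
  by (simp add: algebra_simps)

text \<open>The k-th dimension subgroup of the Magnus representation; it turns out to be
  \<open>lcs G k\<close>.\<close>

definition dim :: "nat \<Rightarrow> 'a set" where
  "dim k = {g \<in> carrier G. M g - 1 \<in> deg_ge k}"

lemma subgroup_dim: "subgroup (dim k) G"
proof
  fix g h assume "g \<in> dim k" "h \<in> dim k"
  then show "g \<otimes> h \<in> dim k"
    by (auto simp: dim_def M_mult_minus_one simp del: M_mult intro!: deg_ge_add deg_ge_mult_right)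
next
  fix g assume "g \<in> dim k"
  then show "inv g \<in> dim k"
    by (auto simp: dim_def M_inv_minus_one intro!: deg_ge_uminus deg_ge_mult_left)
qed (auto simp: dim_def deg_ge_zero)

text \<open>a b^-1 - 1 = (a - b) b^-1 under \<open>M\<close>, and multiplying by a unit preserves
  the degree ideals. Congruence modulo \<open>dim k\<close> thus becomes a condition on a
  difference.\<close>

lemma mult_inv_in_dim_iff:
  assumes "a \<in> carrier G" "b \<in> carrier G"
  shows "a \<otimes> inv b \<in> dim k \<longleftrightarrow> M a - M b \<in> deg_ge k"
proof -
  have 1: "M (a \<otimes> inv b) - 1 = (M a - M b) * M (inv b)"
    and 2: "M a - M b = (M (a \<otimes> inv b) - 1) * M b"
    using assms by (simp_all add: algebra_simps)
  have "a \<otimes> inv b \<in> dim k \<longleftrightarrow> M (a \<otimes> inv b) - 1 \<in> deg_ge k"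
    using assms by (simp add: dim_def)
  also have "\<dots> \<longleftrightarrow> M a - M b \<in> deg_ge k"
    using deg_ge_mult_right 1 2 by metis
  finally show ?thesis .
qed

lemma dim_one: "dim (Suc 0) = carrier G"
proof -
  have "x ` {..<n} \<subseteq> dim (Suc 0)" using mvar_deg_ge by (auto simp: dim_def)
  then show ?thesis
    using generate_subgroup_incl[OF _ subgroup_dim] generate_x subgroup.subset[OF subgroup_dim]
      by blast
qed

text \<open>a b a^-1 b^-1 - 1 = (ab - ba) a^-1 b^-1, and a ring bracket does not change when
  constants are subtracted from its entries. Group commutators thus follow brackets in
  degree.\<close>

lemma M_gcomm:
  assumes "a \<in> carrier G" "b \<in> carrier G"
  shows "M (gcomm G a b) - 1 =
    ((M a - 1) * (M b - 1) - (M b - 1) * (M a - 1)) * (M (inv a) * M (inv b))"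
proof -
  have "M b * M a * (M (inv a) * M (inv b)) = 1"
    using assms by (simp add: mult.assoc) (simp add: mult.assoc[symmetric])
  moreover have "(M a - 1) * (M b - 1) - (M b - 1) * (M a - 1) = M a * M b - M b * M a"
    by (simp add: algebra_simps)
  ultimately show ?thesis
    using assms by (simp add: gcomm_def left_diff_distrib mult.assoc)
qed

lemma gcomm_in_dim: "a \<in> dim i \<Longrightarrow> b \<in> dim j \<Longrightarrow> gcomm G a b \<in> dim (i + j)"
  unfolding dim_def
    using deg_ge_mult[of "M a - 1" i "M b - 1" j] deg_ge_mult[of "M b - 1" j "M a - 1" i]
  by (simp add: M_gcomm deg_ge_mult_right deg_ge_diff add.commute)

lemma lcs_subset_dim: "lcs G k \<subseteq> dim k"
proof (induction k)
  case 0
  show ?case by (auto simp: dim_def deg_ge_0)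
next
  case (Suc k)
  show ?case
  proof (cases "k = 0")
    case True
    then show ?thesis using dim_one by simp
  next
    case False
    have "{gcomm G a b | a b. a \<in> carrier G \<and> b \<in> lcs G k} \<subseteq> dim (Suc k)"
      using Suc gcomm_in_dim[where i = "Suc 0"] dim_one by auto
    then show ?thesis using False by (simp add: lcs_Suc generate_subgroup_incl subgroup_dim)
  qed
qed

section \<open>Normal closures of the generators and right-normed commutators\<close>

definition ncl :: "nat \<Rightarrow> 'a set" where
  "ncl i = generate G {g \<otimes> x i \<otimes> inv g | g. g \<in> carrier G}"

lemma ncl_normal: "i < n \<Longrightarrow> ncl i \<lhd> G"
  unfolding ncl_def
proof (rule normal_generateI)
  fix h g assume "i < n" "h \<in> {g \<otimes> x i \<otimes> inv g | g. g \<in> carrier G}" "g \<in> carrier G"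
  then obtain k where k: "k \<in> carrier G" "h = k \<otimes> x i \<otimes> inv k" by auto
  then have "g \<otimes> h \<otimes> inv g = (g \<otimes> k) \<otimes> x i \<otimes> inv (g \<otimes> k)"
    using \<open>g \<in> carrier G\<close> \<open>i < n\<close> by (simp add: m_assoc inv_mult_group)
  then show "g \<otimes> h \<otimes> inv g \<in> {g \<otimes> x i \<otimes> inv g | g. g \<in> carrier G}"
    using k \<open>g \<in> carrier G\<close> by blast
qed auto

lemma ncl_subgroup: "i < n \<Longrightarrow> subgroup (ncl i) G"
  using ncl_normal normal_imp_subgroup by blast

lemma x_in_ncl: "i < n \<Longrightarrow> x i \<in> ncl i"
  unfolding ncl_def by (rule generate.incl) (auto intro!: exI[of _ \<one>])

text \<open>Conjugating two conjugates of x_i back by the first conjugator \<open>g\<close> turns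
  the pair into x_i and one conjugate \<open>k\<close> of it, which commute by a defining
  relation.\<close>

lemma ncl_commute: "i < n \<Longrightarrow> a \<in> ncl i \<Longrightarrow> b \<in> ncl i \<Longrightarrow> a \<otimes> b = b \<otimes> a"
  unfolding ncl_def
proof (erule (1) generate_commutative[rotated 2])
  fix s t assume i: "i < n" and "s \<in> {g \<otimes> x i \<otimes> inv g | g. g \<in> carrier G}"
    "t \<in> {g \<otimes> x i \<otimes> inv g | g. g \<in> carrier G}"
  then obtain g h where g: "g \<in> carrier G" "s = g \<otimes> x i \<otimes> inv g"
    and h: "h \<in> carrier G" "t = h \<otimes> x i \<otimes> inv h" by auto
  define k where "k = (inv g \<otimes> h) \<otimes> x i \<otimes> inv (inv g \<otimes> h)"
  have k: "k \<in> carrier G" "x i \<otimes> k = k \<otimes> x i"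
    using x_commutes_conj[OF i, of "inv g \<otimes> h"] g h i by (auto simp: k_def)
  have "t = g \<otimes> k \<otimes> inv g"
    using g h i by (simp add: k_def m_assoc inv_mult_group)
  then have "s \<otimes> t = g \<otimes> (x i \<otimes> k) \<otimes> inv g" "t \<otimes> s = g \<otimes> (k \<otimes> x i) \<otimes> inv g"
    using g k(1) i by (simp_all add: m_assoc)
  then show "s \<otimes> t = t \<otimes> s" using k by simp
qed auto

text \<open>The element c(m, I) of the overview.\<close>

fun lcomm :: "nat \<Rightarrow> nat list \<Rightarrow> 'a" where
  "lcomm m [] = x m"
| "lcomm m (i # I) = gcomm G (x i) (lcomm m I)"

lemma lcomm_closed [simp]: "m < n \<Longrightarrow> set I \<subseteq> {..<n} \<Longrightarrow> lcomm m I \<in> carrier G"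
  by (induction I) auto

lemma lcomm_in_lcs: "m < n \<Longrightarrow> set I \<subseteq> {..<n} \<Longrightarrow> lcomm m I \<in> lcs G (Suc (length I))"
proof (induction I)
  case (Cons i I)
  then show ?case using gcomm_in_lcs[of "Suc (length I)" "x i"] by simp
qed simp

text \<open>A commutator with one entry in a normal subgroup lies in it: [a, b] is read as (a b
  a^-1) b^-1 or as a (b a^-1 b^-1), depending on the entry.\<close>

lemma lcomm_in_ncl: "m < n \<Longrightarrow> set I \<subseteq> {..<n} \<Longrightarrow> k \<in> insert m (set I) \<Longrightarrow> lcomm m I \<in> ncl k"
proof (induction I)
  case Nil
  then show ?case by (simp add: x_in_ncl)
next
  case (Cons i I)
  then have i: "i < n" and k: "k < n" and c: "lcomm m I \<in> carrier G" by auto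
  interpret N: normal "ncl k" G using k by (rule ncl_normal)
  show ?case
  proof (cases "k \<in> insert m (set I)")
    case True
    then have "lcomm m I \<in> ncl k" using Cons by auto
    then have "(x i \<otimes> lcomm m I \<otimes> inv (x i)) \<otimes> inv (lcomm m I) \<in> ncl k"
      using i by (intro N.m_closed N.m_inv_closed N.inv_op_closed2) auto
    then show ?thesis by (simp add: gcomm_def)
  next
    case False
    then have "k = i" using Cons by auto
    then have "x i \<otimes> (lcomm m I \<otimes> inv (x i) \<otimes> inv (lcomm m I)) \<in> ncl k"
      using c i by (intro N.m_closed N.inv_op_closed2 N.m_inv_closed) (auto simp: x_in_ncl)
    then show ?thesis using c i by (simp add: gcomm_def m_assoc)
  qed
qed

lemma gcomm_one_right: "a \<in> carrier G \<Longrightarrow> gcomm G a \<one> = \<one>"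
  by (simp add: gcomm_def)

lemma gcomm_eq_one: "a \<in> carrier G \<Longrightarrow> b \<in> carrier G \<Longrightarrow> a \<otimes> b = b \<otimes> a \<Longrightarrow> gcomm G a b = \<one>"
  by (simp add: gcomm_def m_assoc)

text \<open>If i recurs in I, then c(m, I) already lies in the abelian group \<open>ncl i\<close>,
  hence commutes with x_i.\<close>

lemma lcomm_not_distinct: "m < n \<Longrightarrow> set I \<subseteq> {..<n} \<Longrightarrow> \<not> distinct I \<Longrightarrow> lcomm m I = \<one>"
proof (induction I)
  case (Cons i I)
  show ?case
  proof (cases "i \<in> set I")
    case True
    then have "lcomm m I \<in> ncl i" using Cons lcomm_in_ncl by auto
    then show ?thesis
      using Cons ncl_commute[of i "x i" "lcomm m I"] by (simp add: gcomm_eq_one x_in_ncl)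
  next
    case False
    then show ?thesis using Cons by (simp add: gcomm_one_right)
  qed
qed simp

text \<open>The first equation is the definition of the commutator d = [x_i, c]. Since x_i and d
  both lie in the abelian \<open>ncl i\<close>, they commute, and conjugation by x_i^-1 replaces d
  by d^-1.\<close>

lemma lcomm_conj:
  assumes "m < n" "set I \<subseteq> {..<n}" "i < n"
  shows "x i \<otimes> lcomm m I \<otimes> inv (x i) = lcomm m (i # I) \<otimes> lcomm m I"
    and "inv (x i) \<otimes> lcomm m I \<otimes> x i = inv (lcomm m (i # I)) \<otimes> lcomm m I"
proof -
  let ?c = "lcomm m I" and ?d = "lcomm m (i # I)"
  have c: "?c \<in> carrier G" "?d \<in> carrier G" using assms by auto
  show eq: "x i \<otimes> ?c \<otimes> inv (x i) = ?d \<otimes> ?c"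
    using assms c by (simp add: gcomm_def m_assoc)
  have comm: "x i \<otimes> ?d = ?d \<otimes> x i"
    using assms lcomm_in_ncl[of m "i # I" i]
      by (auto intro: ncl_commute x_in_ncl simp del: lcomm.simps)
  have "x i \<otimes> inv ?d = inv ?d \<otimes> x i"
    using commutes_inv[OF _ c(2) comm] assms by simp
  then have "x i \<otimes> (inv ?d \<otimes> ?c) = inv ?d \<otimes> (x i \<otimes> ?c)"
    using assms c by (simp add: m_assoc[symmetric] del: lcomm.simps)
  also have "x i \<otimes> ?c = x i \<otimes> ?c \<otimes> inv (x i) \<otimes> x i"
    using assms c by (simp add: m_assoc)
  also have "inv ?d \<otimes> (x i \<otimes> ?c \<otimes> inv (x i) \<otimes> x i) = ?c \<otimes> x i"
    unfolding eq using assms c by (simp add: m_assoc del: lcomm.simps)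
  finally have "x i \<otimes> (inv ?d \<otimes> ?c) = ?c \<otimes> x i" .
  then have "inv (x i) \<otimes> (?c \<otimes> x i) = inv (x i) \<otimes> (x i \<otimes> (inv ?d \<otimes> ?c))" by simp
  also have "\<dots> = inv ?d \<otimes> ?c" using assms c by (simp del: lcomm.simps)
  finally show "inv (x i) \<otimes> ?c \<otimes> x i = inv ?d \<otimes> ?c"
    using assms c by (simp add: m_assoc del: lcomm.simps)
qed

end

text \<open>The Lie bracket [X_(i_1), [..., [X_(i_k), X_m]]], the ring counterpart of
  \<open>lcomm\<close>.\<close>

fun lie_mon :: "nat \<Rightarrow> nat list \<Rightarrow> magnus" where
  "lie_mon m [] = mvar m"
| "lie_mon m (i # I) = mvar i * lie_mon m I - lie_mon m I * mvar i"

lemma lie_mon_with_var: "lie_mon m I \<in> with_var m"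
  by (induction I) (auto intro: mvar_with_var with_var_diff with_var_mult_left with_var_mult_right)

text \<open>Of the monomials in the expanded bracket only X_I X_m ends in X_m. Monomials ending in
  X_m therefore form a dual system to these brackets, which later reads off exponents.\<close>

lemma mcoeff_lie_mon:
  "m \<notin> set I \<Longrightarrow> distinct (J @ [m]) \<Longrightarrow> mcoeff (lie_mon m I) (J @ [m]) = of_bool (J = I)"
proof (induction I arbitrary: J)
  case (Cons i I)
  have "mcoeff (mvar i * lie_mon m I) (J @ [m]) = of_bool (J = i # I)"
  proof (cases J)
    case Nil
    then show ?thesis using Cons.prems mcoeff_mvar_mult[of m "[]"] by simp
  next
    case (Cons j J')
    then show ?thesis
      using Cons.prems Cons.IH[of J'] mcoeff_mvar_mult[of j "J' @ [m]" i "lie_mon m I"] by simp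
  qed
  \<comment> \<open>The other half of the bracket ends in X_i, and i differs from m.\<close>
  then show ?case using Cons.prems mcoeff_mult_mvar[of J m] by simp
qed auto

context reduced_free_group
begin

text \<open>The expansion has no terms beyond the bracket: in \<open>M_gcomm\<close> the inverses
  contribute only products in which X_i or X_m occurs twice.\<close>

lemma M_lcomm: "m < n \<Longrightarrow> set I \<subseteq> {..<n} \<Longrightarrow> M (lcomm m I) = 1 + lie_mon m I"
proof (induction I)
  case (Cons i I)
  let ?Y = "lie_mon m I"
  have i: "i < n" and c: "lcomm m I \<in> carrier G" and Mc: "M (lcomm m I) = 1 + ?Y" using Cons by auto
  have YY: "?Y * f * ?Y = 0" for f
    by (intro with_var_mult_with_var[of _ m] with_var_mult_right lie_mon_with_var)
  have Y2: "?Y * ?Y = 0" using YY[of 1] by simp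
  have Minv: "M (inv (lcomm m I)) = 1 - ?Y"
    by (rule M_inv_eqI[OF c]) (simp add: Mc Y2 algebra_simps)
  have "M (lcomm m (i # I)) - 1 = (mvar i * ?Y - ?Y * mvar i) * (1 - mvar i) * (1 - ?Y)"
    using M_gcomm[of "x i" "lcomm m I"] i c by (simp add: Minv Mc mult.assoc)
  also have "(mvar i * ?Y - ?Y * mvar i) * (1 - mvar i) = mvar i * ?Y - ?Y * mvar i"
    using mvar_mult_mvar[of i ?Y] mvar_square[of i] by (simp add: algebra_simps)
  also have "\<dots> * (1 - ?Y) = mvar i * ?Y - ?Y * mvar i"
    using YY[of "mvar i"] Y2 by (simp add: algebra_simps)
  finally show ?case by (simp add: algebra_simps)
qed simp

section \<open>Peeling off the last generator\<close>

definition lcomms :: "nat \<Rightarrow> 'a set" where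
  "lcomms m = lcomm m ` lists {..<m}"

lemma lcomms_subset: "m < n \<Longrightarrow> lcomms m \<subseteq> carrier G"
  by (auto simp: lcomms_def lists_eq_set intro!: lcomm_closed)

lemma lcomms_commute:
  assumes "m < n" "a \<in> generate G (lcomms m)" "b \<in> generate G (lcomms m)"
  shows "a \<otimes> b = b \<otimes> a"
proof -
  have "lcomms m \<subseteq> ncl m"
    using assms(1) by (auto simp: lcomms_def lists_eq_set intro!: lcomm_in_ncl)
  then have "generate G (lcomms m) \<subseteq> ncl m"
    using generate_subgroup_incl ncl_subgroup[OF assms(1)] by blast
  then show ?thesis using assms ncl_commute by blast
qed

lemma lcomms_comm_group:
  assumes "m < n"
  shows "comm_group (subgroup_generated G (lcomms m))"
proof (rule group.group_comm_groupI)
  fix a b assume "a \<in> carrier (subgroup_generated G (lcomms m))"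
    "b \<in> carrier (subgroup_generated G (lcomms m))"
  then show "a \<otimes>\<^bsub>subgroup_generated G (lcomms m)\<^esub> b = b \<otimes>\<^bsub>subgroup_generated G (lcomms m)\<^esub> a"
    using lcomms_commute[OF assms] lcomms_subset[OF assms]
    by (simp add: carrier_subgroup_generated inf.absorb2)
qed simp

text \<open>By \<open>lcomm_conj\<close>, conjugating c(m, I) by x_i or its inverse only multiplies
  it by a power of c(m, i # I), and i # I still has all letters below m.\<close>

lemma lcomms_conj_closed:
  assumes "m < n" "v \<in> generate G (x ` {..<m})" "a \<in> generate G (lcomms m)"
  shows "v \<otimes> a \<otimes> inv v \<in> generate G (lcomms m)"
proof (rule generate_conj_closed[OF _ lcomms_subset[OF assms(1)] _ _ assms(2,3)])
  show "x ` {..<m} \<subseteq> carrier G" using assms(1) by auto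
next
  fix s t assume "s \<in> x ` {..<m}" "t \<in> lcomms m"
  then obtain i I where i: "i < m" "s = x i" and I: "set I \<subseteq> {..<m}" "t = lcomm m I"
    by (auto simp: lcomms_def lists_eq_set)
  then have mem: "lcomm m (i # I) \<in> generate G (lcomms m)" "lcomm m I \<in> generate G (lcomms m)"
    by (auto simp: lcomms_def lists_eq_set simp del: lcomm.simps intro!: generate.incl)
  have I': "set I \<subseteq> {..<n}" "i < n" using i I assms(1) by auto
  show "s \<otimes> t \<otimes> inv s \<in> generate G (lcomms m)"
    unfolding i I lcomm_conj(1)[OF assms(1) I'] using mem by (rule generate.eng)
  show "inv s \<otimes> t \<otimes> s \<in> generate G (lcomms m)"
    unfolding i I lcomm_conj(2)[OF assms(1) I']
    using generate_m_inv_closed[OF lcomms_subset[OF assms(1)] mem(1)] mem(2) by (rule generate.eng)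
qed

text \<open>The subgroup generated by x_0, ..., x_m is the span of the c(m, I) times the subgroup
  generated by x_0, ..., x_(m-1). The generator x_m itself is c(m, []).\<close>

lemma lcomms_decomposition:
  assumes m: "m < n" and g: "g \<in> generate G (x ` {..<Suc m})"
  shows "\<exists>a \<in> generate G (lcomms m). \<exists>v \<in> generate G (x ` {..<m}). g = a \<otimes> v"
  using g
proof (induction rule: generate.induct)
  case one
  then show ?case by (rule bexI[of _ \<one>], rule bexI[of _ \<one>]) (auto intro: generate.one)
next
  case (incl h)
  then obtain i where i: "i \<le> m" "h = x i" by (auto simp: less_Suc_eq_le)
  show ?case
  proof (cases "i = m")
    case True
    have "lcomm m [] \<in> lcomms m" unfolding lcomms_def by (rule imageI) auto
    then show ?thesis using True i m
      by (intro bexI[of _ "x m"] bexI[of _ \<one>]) (auto intro: generate.one generate.incl)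
  next
    case False
    then show ?thesis using i m
      by (intro bexI[of _ \<one>] bexI[of _ "x i"]) (auto intro: generate.one generate.incl)
  qed
next
  case (inv h)
  then obtain i where i: "i \<le> m" "h = x i" by (auto simp: less_Suc_eq_le)
  show ?case
  proof (cases "i = m")
    case True
    have "lcomm m [] \<in> lcomms m" unfolding lcomms_def by (rule imageI) auto
    then show ?thesis using True i m
      by (intro bexI[of _ "inv (x m)"] bexI[of _ \<one>]) (auto intro: generate.one generate.inv)
  next
    case False
    then show ?thesis using i m
      by (intro bexI[of _ \<one>] bexI[of _ "inv (x i)"]) (auto intro: generate.one generate.inv)
  qed
next
  case (eng h1 h2)
  then obtain a1 v1 a2 v2 where
    h1: "a1 \<in> generate G (lcomms m)" "v1 \<in> generate G (x ` {..<m})" "h1 = a1 \<otimes> v1" and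
    h2: "a2 \<in> generate G (lcomms m)" "v2 \<in> generate G (x ` {..<m})" "h2 = a2 \<otimes> v2" by auto
  have "a1 \<in> carrier G" "a2 \<in> carrier G" "v1 \<in> carrier G" "v2 \<in> carrier G"
    using h1 h2 m generate_in_carrier[OF lcomms_subset[OF m]] generate_x_closed[of "{..<m}"] by auto
  \<comment> \<open>Moving \<open>v1\<close> past \<open>a2\<close> conjugates \<open>a2\<close>,
    which stays in the span of the c(m, I).\<close>
  then have "h1 \<otimes> h2 = a1 \<otimes> (v1 \<otimes> a2 \<otimes> inv v1) \<otimes> (v1 \<otimes> v2)"
    using h1 h2 by (simp add: m_assoc)
  moreover have "a1 \<otimes> (v1 \<otimes> a2 \<otimes> inv v1) \<in> generate G (lcomms m)"
    by (rule generate.eng[OF h1(1) lcomms_conj_closed[OF m h1(2) h2(1)]])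
  moreover have "v1 \<otimes> v2 \<in> generate G (x ` {..<m})" by (rule generate.eng[OF h1(2) h2(2)])
  ultimately show ?case by blast
qed

text \<open>This ideal has square zero, so \<open>M a - 1\<close> is additive in \<open>a\<close>;
  it also separates the factor \<open>a\<close> from the factor free of X_m in the decomposition
  above.\<close>

lemma M_lcomms:
  assumes m: "m < n" and a: "a \<in> generate G (lcomms m)"
  shows "M a - 1 \<in> with_var m"
proof -
  have lcomm: "c \<in> carrier G \<and> M c - 1 \<in> with_var m" if c: "c \<in> lcomms m" for c
  proof -
    obtain I where "c = lcomm m I" "set I \<subseteq> {..<m}"
      using c by (auto simp: lcomms_def lists_eq_set)
    moreover from this have "set I \<subseteq> {..<n}" using m by auto
    ultimately show ?thesis using m by (simp add: M_lcomm lie_mon_with_var)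
  qed
  show ?thesis using a
  proof (induction rule: generate.induct)
    case one
    then show ?case by (simp add: with_var_def)
  next
    case (incl h)
    then show ?case using lcomm by blast
  next
    case (inv h)
    then show ?case
      using lcomm[OF inv] by (simp add: M_inv_minus_one with_var_uminus with_var_mult_left)
  next
    case (eng h1 h2)
    then have "h1 \<in> carrier G" "h2 \<in> carrier G"
      using generate_in_carrier[OF lcomms_subset[OF m]] by auto
    then show ?case using eng
      by (simp add: M_mult_minus_one with_var_add with_var_mult_right del: M_mult)
  qed
qed

text \<open>Both sides are multiplicative in \<open>a\<close>, because the coefficients are additive
  and the c(m, I) commute. It remains to test a = c(m, J): for repetition-free J the exponents are a
  Kronecker delta, otherwise c(m, J) is trivial.\<close>

lemma lcomms_normal_form:
  assumes m: "m < n" and a: "a \<in> generate G (lcomms m)"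
  shows "finprod (subgroup_generated G (lcomms m)) (\<lambda>I. lcomm m I [^] mcoeff (M a) (I @ [m]))
    {I. set I \<subseteq> {..<m} \<and> distinct I} = a" (is "finprod ?A (?f a) ?L = a")
proof -
  interpret A: comm_group ?A using m by (rule lcomms_comm_group)
  have carrA: "carrier ?A = generate G (lcomms m)"
    using lcomms_subset[OF m] by (simp add: carrier_subgroup_generated inf.absorb2)
  have lcA: "lcomm m I \<in> generate G (lcomms m)" if "set I \<subseteq> {..<m}" for I
    using that by (auto simp: lcomms_def lists_eq_set intro!: generate.incl)
  have lcG: "lcomm m I \<in> carrier G" if "set I \<subseteq> {..<m}" for I
    using that m by (intro lcomm_closed) auto
  have fA: "lcomm m I [^] (k::int) \<in> carrier ?A" if "set I \<subseteq> {..<m}" for I k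
    unfolding carrA
      using subgroup_int_pow_closed[OF generate_is_subgroup[OF lcomms_subset[OF m]] lcA[OF that]] .
  have fin: "finite ?L"
  proof (rule finite_subset)
    show "?L \<subseteq> {I. set I \<subseteq> {..<m} \<and> length I \<le> m}"
    proof clarify
      fix I assume I: "set I \<subseteq> {..<m}" "distinct I"
      show "length I \<le> m"
        using distinct_card[OF I(2)] card_mono[OF _ I(1)] by simp
    qed
    show "finite {I. set I \<subseteq> {..<m} \<and> length I \<le> m}" by (rule finite_lists_length_le) simp
  qed
  have one: "finprod ?A (?f \<one>) ?L = \<one>"
    using A.finprod_one_eqI[of ?L "?f \<one>"] by simp
  have mult: "finprod ?A (?f (a \<otimes> b)) ?L = finprod ?A (?f a) ?L \<otimes> finprod ?A (?f b) ?L"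
    if a: "a \<in> generate G (lcomms m)" and b: "b \<in> generate G (lcomms m)" for a b
  proof -
    have ab: "a \<in> carrier G" "b \<in> carrier G"
      using a b generate_in_carrier[OF lcomms_subset[OF m]] by auto
    have "M (a \<otimes> b) = (M a - 1) * (M b - 1) + (M a - 1) + (M b - 1) + 1"
      using ab by (simp add: algebra_simps)
    \<comment> \<open>The only obstacle to additivity of the coefficients vanishes in the
      square-zero ideal.\<close>
    also have "(M a - 1) * (M b - 1) = 0"
      using M_lcomms[OF m] a b with_var_mult_with_var by blast
    finally have coeff:
      "mcoeff (M (a \<otimes> b)) (I @ [m]) = mcoeff (M a) (I @ [m]) + mcoeff (M b) (I @ [m])" for I
      by simp
    have "finprod ?A (?f (a \<otimes> b)) ?L = finprod ?A (\<lambda>I. ?f a I \<otimes>\<^bsub>?A\<^esub> ?f b I) ?L"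
    proof (rule A.finprod_cong')
      show "(\<lambda>I. ?f a I \<otimes>\<^bsub>?A\<^esub> ?f b I) \<in> ?L \<rightarrow> carrier ?A" using fA A.m_closed by blast
      fix I assume "I \<in> ?L"
      then show "?f (a \<otimes> b) I = ?f a I \<otimes>\<^bsub>?A\<^esub> ?f b I"
        using lcG by (simp add: coeff int_pow_mult)
    qed simp
    also have "\<dots> = finprod ?A (?f a) ?L \<otimes>\<^bsub>?A\<^esub> finprod ?A (?f b) ?L"
      by (rule A.finprod_multf) (use fA in auto)
    finally show ?thesis by simp
  qed
  have gens: "finprod ?A (?f c) ?L = c" if c: "c \<in> lcomms m" for c
  proof -
    obtain J where J: "set J \<subseteq> {..<m}" "c = lcomm m J"
      using c by (auto simp: lcomms_def lists_eq_set)
    have J': "set J \<subseteq> {..<n}" using J m by auto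
    show ?thesis
    proof (cases "distinct J")
      case True
      have "finprod ?A (?f c) ?L = finprod ?A (\<lambda>I. if I = J then lcomm m I else \<one>\<^bsub>?A\<^esub>) ?L"
      proof (rule A.finprod_cong')
        show "(\<lambda>I. if I = J then lcomm m I else \<one>\<^bsub>?A\<^esub>) \<in> ?L \<rightarrow> carrier ?A"
          using lcA A.one_closed by (auto simp: carrA generate.one)
        fix I assume I: "I \<in> ?L"
        have "m \<notin> set J" "m \<notin> set I" using I J by auto
        then have "mcoeff (M c) (I @ [m]) = of_bool (I = J)"
          using I J mcoeff_lie_mon[of m J I] by (simp add: M_lcomm[OF m J'])
        then show "?f c I = (if I = J then lcomm m I else \<one>\<^bsub>?A\<^esub>)"
          using lcG I by auto
      qed simp
      also have "\<dots> = lcomm m J"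
        by (rule A.finprod_singleton_swap) (use True J fin lcA in \<open>auto simp: carrA\<close>)
      finally show ?thesis using J by simp
    next
      case False
      then have "c = \<one>" using lcomm_not_distinct[OF m J'] J by simp
      then show ?thesis using one by simp
    qed
  qed
  show ?thesis using a
  proof (induction rule: generate.induct)
    case one
    show ?case by (rule \<open>finprod ?A (?f \<one>) ?L = \<one>\<close>)
  next
    case (incl h)
    then show ?case by (rule gens)
  next
    case (inv h)
    have h: "h \<in> carrier G" using inv lcomms_subset[OF m] by auto
    have "finprod ?A (?f (inv h)) ?L \<in> carrier ?A" by (rule A.finprod_closed) (use fA in auto)
    then have F: "finprod ?A (?f (inv h)) ?L \<in> carrier G"
      unfolding carrA using generate_in_carrier[OF lcomms_subset[OF m]] by blast
    \<comment> \<open>Multiplicativity at h^-1 and h, together with the known value at the generator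
      h, determines the value at h^-1.\<close>
    have "finprod ?A (?f (inv h)) ?L \<otimes> h = \<one>"
      using mult[OF generate.inv[OF inv] generate.incl[OF inv]] one gens[OF inv] h by simp
    then show ?case using inv_equality[OF _ h F] by simp
  next
    case (eng h1 h2)
    then show ?case using mult by simp
  qed
qed

text \<open>Writing g = a v, the factor v accounts for the part of \<open>M g\<close> without X_m,
  so v and then a inherit the degree bound. The normal form of a then uses only c(m, I) of weight at
  least j. A general \<open>Q\<close> allows both Q = \<Gamma>_k and Q = 1.\<close>

lemma dim_subset_subgroup:
  assumes Q: "subgroup Q G"
  shows "m \<le> n \<Longrightarrow>
    (\<And>k I. k < m \<Longrightarrow> set I \<subseteq> {..<k} \<Longrightarrow> distinct I \<Longrightarrow> j \<le> Suc (length I) \<Longrightarrow> lcomm k I \<in> Q) \<Longrightarrow>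
    g \<in> generate G (x ` {..<m}) \<Longrightarrow> g \<in> dim j \<Longrightarrow> g \<in> Q"
proof (induction m arbitrary: g)
  interpret Q: subgroup Q G by fact
  case 0
  then show ?case by (simp add: generate_empty)
next
  interpret Q: subgroup Q G by fact
  case (Suc m)
  then have m: "m < n" by simp
  obtain a v where a: "a \<in> generate G (lcomms m)" and v: "v \<in> generate G (x ` {..<m})"
    and g: "g = a \<otimes> v"
    using lcomms_decomposition[OF m Suc.prems(3)] by blast
  have ac: "a \<in> carrier G" using a generate_in_carrier[OF lcomms_subset[OF m]] by auto
  have vc: "v \<in> carrier G" using v generate_x_closed[of "{..<m}"] m by auto
  have Mv: "M v \<in> over_vars {..<m}" using M_over_vars[OF _ v] m by auto
  have Ma: "(M a - 1) * M v \<in> with_var m" using M_lcomms[OF m a] by (rule with_var_mult_right)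
  have Mg: "M g = (M a - 1) * M v + M v" using g ac vc by (simp add: algebra_simps)
  have "mcoeff (M v - 1) l = 0" if "length l < j" for l
  \<comment> \<open>Words containing m do not occur in \<open>M v\<close>; on the others
    \<open>M v\<close> and \<open>M g\<close> agree, as their difference lies in the ideal of
    X_m.\<close>
  proof (cases "m \<in> set l")
    case True
    then have "mcoeff (M v) l = 0" using Mv by (auto simp: over_vars_def)
    then show ?thesis using True by auto
  next
    case False
    then have "mcoeff (M v - 1) l = mcoeff (M g - 1) l" using Ma by (simp add: Mg with_var_def)
    then show ?thesis using Suc.prems(4) that by (simp add: dim_def deg_ge_def)
  qed
  then have "v \<in> dim j" using vc by (auto simp: dim_def deg_ge_def)
  then have vQ: "v \<in> Q" using Suc.IH[of v] Suc.prems m v by auto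
  interpret D: subgroup "dim j" G by (rule subgroup_dim)
  have "g \<otimes> inv v \<in> dim j" using Suc.prems(4) \<open>v \<in> dim j\<close> by simp
  then have aD: "a \<in> dim j" using g ac vc by (simp add: m_assoc)
  have "finprod (subgroup_generated G (lcomms m)) (\<lambda>I. lcomm m I [^] mcoeff (M a) (I @ [m]))
    {I. set I \<subseteq> {..<m} \<and> distinct I} \<in> Q"
  proof (rule finprod_subgroup_generated_mem[OF lcomms_comm_group[OF m] Q])
    fix I assume I: "I \<in> {I. set I \<subseteq> {..<m} \<and> distinct I}"
    have "lcomm m I \<in> generate G (lcomms m)"
      using I by (auto simp: lcomms_def lists_eq_set intro!: generate.incl)
    then have "lcomm m I [^] mcoeff (M a) (I @ [m]) \<in> generate G (lcomms m)"
      by (rule subgroup_int_pow_closed[OF generate_is_subgroup[OF lcomms_subset[OF m]]])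
    then show "lcomm m I [^] mcoeff (M a) (I @ [m]) \<in> carrier (subgroup_generated G (lcomms m))"
      using lcomms_subset[OF m] by (simp add: carrier_subgroup_generated inf.absorb2)
    show "lcomm m I [^] mcoeff (M a) (I @ [m]) \<in> Q"
    proof (cases "j \<le> Suc (length I)")
      case True
      then show ?thesis using Suc.prems(2)[of m I] I subgroup_int_pow_closed[OF Q] by simp
    next
      case False
      \<comment> \<open>X_I X_m has degree \<open>Suc (length I)\<close>, below j here, so the
        exponent is zero.\<close>
      then have "mcoeff (M a - 1) (I @ [m]) = 0" using aD unfolding dim_def deg_ge_def by auto
      then show ?thesis by simp
    qed
  qed
  then have "a \<in> Q" using lcomms_normal_form[OF m a] by simp
  then show ?case using g vQ by simp
qed

text \<open>c(m, I) lies in \<Gamma>_(|I|+1), so the lower central series term itself can serve as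
  the subgroup \<open>Q\<close> above.\<close>

theorem lcs_eq_dim: "lcs G k = dim k"
proof
  show "dim k \<subseteq> lcs G k"
  proof
    fix g assume g: "g \<in> dim k"
    show "g \<in> lcs G k"
    proof (rule dim_subset_subgroup[OF subgroup_lcs _ _ _ g, of n])
      fix m I assume mI: "m < n" "set I \<subseteq> {..<m}" "k \<le> Suc (length I)"
      then have "lcomm m I \<in> lcs G (Suc (length I))" by (intro lcomm_in_lcs) auto
      moreover have "lcs G (Suc (length I)) \<subseteq> lcs G k"
        using mI(3) by (rule lift_Suc_antimono_le[of "lcs G", OF lcs_antimono])
      ultimately show "lcomm m I \<in> lcs G k" by blast
    qed (use g in \<open>simp_all add: generate_x dim_def\<close>)
  qed
qed (rule lcs_subset_dim)

text \<open>A repetition-free word in letters below m < n has length at most m, so no c(m, I) of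
  weight k > n has to be put into Q = 1.\<close>

theorem lcs_trivial: "n < k \<Longrightarrow> lcs G k = {\<one>}"
proof
  assume k: "n < k"
  show "lcs G k \<subseteq> {\<one>}"
  proof
    fix g assume g: "g \<in> lcs G k"
    show "g \<in> {\<one>}"
    proof (rule dim_subset_subgroup[OF triv_subgroup, of n k])
      fix m I assume mI: "m < n" "set I \<subseteq> {..<m}" "distinct I" "k \<le> Suc (length I)"
      have "length I \<le> m" using distinct_card[OF mI(3)] card_mono[OF _ mI(2)] by simp
      then show "lcomm m I \<in> {\<one>}" using mI k by simp
    qed (use g in \<open>auto simp: generate_x lcs_eq_dim dim_def\<close>)
  qed
qed (simp add: subgroup.one_closed[OF subgroup_lcs])

end

section \<open>Basis-conjugating automorphisms\<close>

lemma (in group) gcomm_consistent: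
  assumes "subgroup H G" "a \<in> H" "b \<in> H"
  shows "gcomm (G\<lparr>carrier := H\<rparr>) a b = gcomm G a b"
  using assms by (simp add: gcomm_def m_inv_consistent)

lemma hom_eq_on_generate:
  assumes "group G" "group H" "h1 \<in> hom G H" "h2 \<in> hom G H" "S \<subseteq> carrier G"
    and "\<And>s. s \<in> S \<Longrightarrow> h1 s = h2 s" and "g \<in> generate G S"
  shows "h1 g = h2 g"
proof -
  interpret h1: group_hom G H h1 using assms by (simp add: group_hom_def group_hom_axioms_def)
  interpret h2: group_hom G H h2 using assms by (simp add: group_hom_def group_hom_axioms_def)
  show ?thesis using assms(7)
  proof (induction rule: generate.induct)
    case (inv h)
    then have "h \<in> carrier G" using assms(5) by auto
    then show ?case using assms(6)[OF inv] by simp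
  next
    case (eng a b)
    then have "a \<in> carrier G" "b \<in> carrier G" using h1.G.generate_in_carrier[OF assms(5)] by auto
    then show ?case using eng by simp
  qed (use assms(6) in simp_all)
qed

section \<open>Automorphisms of an arbitrary group\<close>

context group
begin

lemma auto_hom: "\<sigma> \<in> auto G \<Longrightarrow> \<sigma> \<in> hom G G"
  by (simp add: auto_def)

lemma auto_closed: "\<sigma> \<in> auto G \<Longrightarrow> g \<in> carrier G \<Longrightarrow> \<sigma> g \<in> carrier G"
  using hom_in_carrier[OF auto_hom] .

lemma auto_mult: "\<sigma> \<in> auto G \<Longrightarrow> g \<in> carrier G \<Longrightarrow> h \<in> carrier G \<Longrightarrow> \<sigma> (g \<otimes> h) = \<sigma> g \<otimes> \<sigma> h"
  using hom_mult[OF auto_hom] .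

lemma auto_inv: "\<sigma> \<in> auto G \<Longrightarrow> g \<in> carrier G \<Longrightarrow> \<sigma> (inv g) = inv (\<sigma> g)"
  using group_hom.hom_inv[of G G \<sigma> g] auto_hom is_group
    by (simp add: group_hom_def group_hom_axioms_def)

lemma carrier_AutoGroup: "carrier (AutoGroup G) = auto G"
  by (simp add: AutoGroup_def)

lemma AutoGroup_mult_apply:
  "\<sigma> \<in> auto G \<Longrightarrow> \<tau> \<in> auto G \<Longrightarrow> g \<in> carrier G \<Longrightarrow> (\<sigma> \<otimes>\<^bsub>AutoGroup G\<^esub> \<tau>) g = \<sigma> (\<tau> g)"
  by (simp add: AutoGroup_def BijGroup_def auto_def compose_def)

lemma AutoGroup_one_apply: "g \<in> carrier G \<Longrightarrow> \<one>\<^bsub>AutoGroup G\<^esub> g = g"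
  by (simp add: AutoGroup_def BijGroup_def)

lemma AutoGroup_inv_closed: "\<sigma> \<in> auto G \<Longrightarrow> inv\<^bsub>AutoGroup G\<^esub> \<sigma> \<in> auto G"
  using group.inv_closed[OF AutoGroup] by (simp add: carrier_AutoGroup)

lemma AutoGroup_mult_closed:
  "\<sigma> \<in> auto G \<Longrightarrow> \<tau> \<in> auto G \<Longrightarrow> \<sigma> \<otimes>\<^bsub>AutoGroup G\<^esub> \<tau> \<in> auto G"
  using monoid.m_closed[OF group.is_monoid[OF AutoGroup]] by (simp add: carrier_AutoGroup)

lemma AutoGroup_inv_apply:
  assumes "\<sigma> \<in> auto G" "g \<in> carrier G"
  shows "\<sigma> ((inv\<^bsub>AutoGroup G\<^esub> \<sigma>) g) = g" "(inv\<^bsub>AutoGroup G\<^esub> \<sigma>) (\<sigma> g) = g"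
proof -
  interpret A: group "AutoGroup G" by (rule AutoGroup)
  have "\<sigma> \<otimes>\<^bsub>AutoGroup G\<^esub> inv\<^bsub>AutoGroup G\<^esub> \<sigma> = \<one>\<^bsub>AutoGroup G\<^esub>"
    "inv\<^bsub>AutoGroup G\<^esub> \<sigma> \<otimes>\<^bsub>AutoGroup G\<^esub> \<sigma> = \<one>\<^bsub>AutoGroup G\<^esub>"
    using assms by (simp_all add: carrier_AutoGroup)
  then show "\<sigma> ((inv\<^bsub>AutoGroup G\<^esub> \<sigma>) g) = g" "(inv\<^bsub>AutoGroup G\<^esub> \<sigma>) (\<sigma> g) = g"
    using assms AutoGroup_mult_apply AutoGroup_inv_closed AutoGroup_one_apply by metis+
qed

lemma auto_lcs: "\<sigma> \<in> auto G \<Longrightarrow> g \<in> lcs G k \<Longrightarrow> \<sigma> g \<in> lcs G k"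
  using lcs_hom[OF is_group is_group auto_hom] .

text \<open>Elements of \<open>auto G\<close> are extensional, that is \<open>undefined\<close> off
  the carrier, so agreement on the carrier suffices.\<close>

lemma auto_eqI:
  assumes "\<sigma> \<in> auto G" "\<tau> \<in> auto G" "\<And>g. g \<in> carrier G \<Longrightarrow> \<sigma> g = \<tau> g"
  shows "\<sigma> = \<tau>"
  using assms extensionalityI[of \<sigma> "carrier G" \<tau>] by (auto simp: auto_def Bij_def)

end

section \<open>The Andreadakis filtration on basis-conjugating automorphisms\<close>

context reduced_free_group
begin

text \<open>\<open>basis_conj\<close> and \<open>andr_filt\<close> are the abstract versions of
  \<open>hPSigma\<close> and \<open>andreadakis\<close>.\<close>

definition basis_conj :: "('a \<Rightarrow> 'a) set" where
  "basis_conj = {\<sigma> \<in> auto G. \<forall>i<n. \<exists>g \<in> carrier G. \<sigma> (x i) = inv g \<otimes> x i \<otimes> g}"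

definition andr_filt :: "nat \<Rightarrow> ('a \<Rightarrow> 'a) set" where
  "andr_filt j = {\<sigma> \<in> auto G. \<forall>i\<ge>1. \<forall>g \<in> lcs G i. \<sigma> g \<otimes> inv g \<in> lcs G (i + j)}"

lemma M_minus_one_deg: "g \<in> carrier G \<Longrightarrow> M g - 1 \<in> deg_ge (Suc 0)"
  using dim_one unfolding dim_def by auto

lemma andr_filt_iff:
  "\<sigma> \<in> andr_filt j \<longleftrightarrow> \<sigma> \<in> auto G \<and> (\<forall>i\<ge>1. \<forall>g \<in> lcs G i. M (\<sigma> g) - M g \<in> deg_ge (i + j))"
  unfolding andr_filt_def using lcs_closed auto_closed
  by (auto simp: lcs_eq_dim mult_inv_in_dim_iff)

lemma andr_filt_auto: "\<sigma> \<in> andr_filt j \<Longrightarrow> \<sigma> \<in> auto G"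
  by (simp add: andr_filt_def)

lemma basis_conj_auto: "\<sigma> \<in> basis_conj \<Longrightarrow> \<sigma> \<in> auto G"
  by (simp add: basis_conj_def)

lemma andr_filt_D: "\<sigma> \<in> andr_filt j \<Longrightarrow> i \<ge> 1 \<Longrightarrow> g \<in> lcs G i \<Longrightarrow> M (\<sigma> g) - M g \<in> deg_ge (i + j)"
  by (simp add: andr_filt_iff)

text \<open>For products, \<sigma>\<tau>g - g splits as (\<sigma>\<tau>g - \<tau>g) + (\<tau>g - g)
  under \<open>M\<close>, with \<tau>g still in \<Gamma>_i. For inverses, the condition is applied
  at the preimage of g.\<close>

lemma subgroup_andr_filt: "subgroup (andr_filt j) (AutoGroup G)"
proof -
  interpret A: group "AutoGroup G" by (rule AutoGroup)
  show ?thesis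
  proof
    show "andr_filt j \<subseteq> carrier (AutoGroup G)" by (auto simp: carrier_AutoGroup andr_filt_def)
    show "\<one>\<^bsub>AutoGroup G\<^esub> \<in> andr_filt j"
      using A.one_closed
        by (auto simp: andr_filt_iff carrier_AutoGroup AutoGroup_one_apply lcs_closed deg_ge_zero)
  next
    fix \<sigma> \<tau> assume s: "\<sigma> \<in> andr_filt j" and t: "\<tau> \<in> andr_filt j"
    show "\<sigma> \<otimes>\<^bsub>AutoGroup G\<^esub> \<tau> \<in> andr_filt j"
      unfolding andr_filt_iff
    proof (intro conjI allI impI ballI)
      show "\<sigma> \<otimes>\<^bsub>AutoGroup G\<^esub> \<tau> \<in> auto G" using s t by (simp add: AutoGroup_mult_closed andr_filt_auto)
      fix i g assume i: "1 \<le> i" and g: "g \<in> lcs G i"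
      have "(\<sigma> \<otimes>\<^bsub>AutoGroup G\<^esub> \<tau>) g = \<sigma> (\<tau> g)"
        using s t g by (simp add: AutoGroup_mult_apply andr_filt_auto lcs_closed)
      moreover have "M (\<sigma> (\<tau> g)) - M (\<tau> g) \<in> deg_ge (i + j)"
        using andr_filt_D[OF s i auto_lcs[OF andr_filt_auto[OF t] g]] .
      moreover have "M (\<tau> g) - M g \<in> deg_ge (i + j)" using andr_filt_D[OF t i g] .
      ultimately show "M ((\<sigma> \<otimes>\<^bsub>AutoGroup G\<^esub> \<tau>) g) - M g \<in> deg_ge (i + j)"
        using deg_ge_add by fastforce
    qed
  next
    fix \<sigma> assume s: "\<sigma> \<in> andr_filt j"
    let ?s = "inv\<^bsub>AutoGroup G\<^esub> \<sigma>"
    have s': "?s \<in> auto G" using s by (simp add: AutoGroup_inv_closed andr_filt_auto)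
    have "M (?s g) - M g \<in> deg_ge (i + j)" if i: "1 \<le> i" and g: "g \<in> lcs G i" for i g
    proof -
      have "M (\<sigma> (?s g)) - M (?s g) \<in> deg_ge (i + j)" using andr_filt_D[OF s i auto_lcs[OF s' g]] .
      then have "- (M g - M (?s g)) \<in> deg_ge (i + j)"
        using AutoGroup_inv_apply(1)[OF andr_filt_auto[OF s] lcs_closed[OF g]]
          by (simp only: deg_ge_uminus)
      then show ?thesis by simp
    qed
    then show "?s \<in> andr_filt j" using s' by (simp add: andr_filt_iff)
  qed
qed

text \<open>If \<sigma> and \<tau> conjugate x_i by g and h, then \<sigma>\<tau> conjugates it by g
  \<sigma>(h), and \<sigma>^-1 by the inverse of \<sigma>^-1(g).\<close>

lemma subgroup_basis_conj: "subgroup basis_conj (AutoGroup G)"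
proof -
  interpret A: group "AutoGroup G" by (rule AutoGroup)
  show ?thesis
  proof
    show "basis_conj \<subseteq> carrier (AutoGroup G)" by (auto simp: carrier_AutoGroup basis_conj_def)
    show "\<one>\<^bsub>AutoGroup G\<^esub> \<in> basis_conj"
      using A.one_closed
        by (auto simp: basis_conj_def carrier_AutoGroup AutoGroup_one_apply intro!: bexI[of _ \<one>])
  next
    fix \<sigma> \<tau> assume s: "\<sigma> \<in> basis_conj" and t: "\<tau> \<in> basis_conj"
    have "\<exists>k \<in> carrier G. (\<sigma> \<otimes>\<^bsub>AutoGroup G\<^esub> \<tau>) (x i) = inv k \<otimes> x i \<otimes> k" if i: "i < n" for i
    proof -
      obtain g h where g: "g \<in> carrier G" "\<sigma> (x i) = inv g \<otimes> x i \<otimes> g"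
        and h: "h \<in> carrier G" "\<tau> (x i) = inv h \<otimes> x i \<otimes> h"
        using s t i unfolding basis_conj_def by blast
      have sh: "\<sigma> h \<in> carrier G" using h s by (simp add: auto_closed basis_conj_auto)
      have "(\<sigma> \<otimes>\<^bsub>AutoGroup G\<^esub> \<tau>) (x i) = \<sigma> (inv h \<otimes> x i \<otimes> h)"
        using s t h i by (simp add: AutoGroup_mult_apply basis_conj_auto)
      also have "\<dots> = inv (\<sigma> h) \<otimes> (inv g \<otimes> x i \<otimes> g) \<otimes> \<sigma> h"
        using s h g i by (simp add: auto_mult[OF basis_conj_auto] auto_inv[OF basis_conj_auto])
      also have "\<dots> = inv (g \<otimes> \<sigma> h) \<otimes> x i \<otimes> (g \<otimes> \<sigma> h)"
        using g sh i by (simp add: m_assoc inv_mult_group)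
      finally show ?thesis using g sh by blast
    qed
    then show "\<sigma> \<otimes>\<^bsub>AutoGroup G\<^esub> \<tau> \<in> basis_conj"
      using s t by (simp add: basis_conj_def AutoGroup_mult_closed)
  next
    fix \<sigma> assume s: "\<sigma> \<in> basis_conj"
    let ?s = "inv\<^bsub>AutoGroup G\<^esub> \<sigma>"
    have s': "?s \<in> auto G" using s by (simp add: AutoGroup_inv_closed basis_conj_auto)
    have "\<exists>k \<in> carrier G. ?s (x i) = inv k \<otimes> x i \<otimes> k" if i: "i < n" for i
    proof -
      obtain g where g: "g \<in> carrier G" "\<sigma> (x i) = inv g \<otimes> x i \<otimes> g"
        using s i unfolding basis_conj_def by blast
      have c: "?s g \<in> carrier G" "?s (x i) \<in> carrier G" using g i s' by (auto simp: auto_closed)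
      have "x i = ?s (inv g \<otimes> x i \<otimes> g)"
        using AutoGroup_inv_apply(2)[OF basis_conj_auto[OF s], of "x i"] g i by simp
      also have "\<dots> = inv (?s g) \<otimes> ?s (x i) \<otimes> ?s g"
        using s' g i by (simp add: auto_mult auto_inv)
      finally have "?s g \<otimes> x i \<otimes> inv (?s g)
          = ?s g \<otimes> (inv (?s g) \<otimes> ?s (x i) \<otimes> ?s g) \<otimes> inv (?s g)" by simp
      also have "\<dots> = ?s (x i)" using c by (simp add: m_assoc)
      finally have "?s g \<otimes> x i \<otimes> inv (?s g) = ?s (x i)" .
      then have "?s (x i) = inv (inv (?s g)) \<otimes> x i \<otimes> inv (?s g)" using c by simp
      then show ?thesis using c inv_closed by blast
    qed
    then show "?s \<in> basis_conj" using s' by (simp add: basis_conj_def)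
  qed
qed

text \<open>g^-1 a g - a = g^-1 (a g - g a): conjugation changes \<open>M a\<close> by a bracket,
  whose degree is at least the sum of those of a - 1 and g - 1.\<close>

lemma M_conj_minus:
  assumes "a \<in> carrier G" "g \<in> carrier G"
  shows "M (inv g \<otimes> a \<otimes> g) - M a = M (inv g) * ((M a - 1) * (M g - 1) - (M g - 1) * (M a - 1))"
proof -
  have "M (inv g) * ((M a - 1) * (M g - 1) - (M g - 1) * (M a - 1))
      = M (inv g) * M a * M g - M (inv g) * M g * M a"
    by (simp add: algebra_simps)
  then show ?thesis using assms by simp
qed

text \<open>The difference \<open>M (\<sigma> g) - M g\<close> obeys a twisted product rule, so a
  degree bound on it can be checked on generators.\<close>

lemma subgroup_M_fix:
  assumes "\<sigma> \<in> hom G G"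
  shows "subgroup {g \<in> carrier G. M (\<sigma> g) - M g \<in> deg_ge d} G"
proof -
  interpret s: group_hom G G \<sigma>
    using assms by (simp add: group_hom_def group_hom_axioms_def is_group)
  show ?thesis
  proof
    fix g h
    assume g: "g \<in> {g \<in> carrier G. M (\<sigma> g) - M g \<in> deg_ge d}"
      and h: "h \<in> {g \<in> carrier G. M (\<sigma> g) - M g \<in> deg_ge d}"
    have "M (\<sigma> (g \<otimes> h)) - M (g \<otimes> h) = (M (\<sigma> g) - M g) * M (\<sigma> h) + M g * (M (\<sigma> h) - M h)"
      using g h by (simp add: algebra_simps)
    moreover have "\<dots> \<in> deg_ge d"
      using g h by (intro deg_ge_add deg_ge_mult_left deg_ge_mult_right) auto
    ultimately show "g \<otimes> h \<in> {g \<in> carrier G. M (\<sigma> g) - M g \<in> deg_ge d}"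
      using g h by (simp del: M_mult)
  next
    fix g assume g: "g \<in> {g \<in> carrier G. M (\<sigma> g) - M g \<in> deg_ge d}"
    then have "M (inv (\<sigma> g)) - M (inv g) \<in> deg_ge d"
      by (simp add: M_inv_minus[of "\<sigma> g" g] deg_ge_uminus deg_ge_mult_left deg_ge_mult_right)
    then show "inv g \<in> {g \<in> carrier G. M (\<sigma> g) - M g \<in> deg_ge d}" using g by simp
  qed (auto simp: deg_ge_zero)
qed

text \<open>Conjugating x_i changes its expansion in degree 2 only and beyond, hence the same holds
  on all of G. Induction along the lower central series then tracks how a commutator changes when
  both entries change.\<close>

lemma basis_conj_subset_andr_filt_one: "basis_conj \<subseteq> andr_filt 1"
proof
  fix \<sigma> assume s: "\<sigma> \<in> basis_conj"
  have hom: "\<sigma> \<in> hom G G" using s by (simp add: auto_hom basis_conj_auto)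
  have "M (\<sigma> (x i)) - M (x i) \<in> deg_ge 2" if i: "i < n" for i
  proof -
    obtain g where g: "g \<in> carrier G" "\<sigma> (x i) = inv g \<otimes> x i \<otimes> g"
      using s i unfolding basis_conj_def by blast
    have "M g - 1 \<in> deg_ge 1" "M (x i) - 1 \<in> deg_ge 1"
      using g i by (simp_all add: M_minus_one_deg del: M_x)
    then have "(M (x i) - 1) * (M g - 1) - (M g - 1) * (M (x i) - 1) \<in> deg_ge (1 + 1)"
      by (rule deg_ge_bracket[rotated])
    then show ?thesis unfolding g(2) using M_conj_minus[of "x i" g] g(1) i
      by (simp add: deg_ge_mult_left numeral_2_eq_2 del: M_mult M_x)
  qed
  then have "x ` {..<n} \<subseteq> {g \<in> carrier G. M (\<sigma> g) - M g \<in> deg_ge 2}" by auto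
  then have one: "M (\<sigma> g) - M g \<in> deg_ge 2" if "g \<in> carrier G" for g
    using generate_subgroup_incl[OF _ subgroup_M_fix[OF hom]] generate_x that by blast
  have "\<forall>g \<in> lcs G i. M (\<sigma> g) - M g \<in> deg_ge (Suc i)" if "1 \<le> i" for i
    using that
  proof (induction i rule: dec_induct)
    case base
    show ?case using one by (simp add: numeral_2_eq_2)
  next
    case (step i)
    have "{gcomm G a b | a b. a \<in> carrier G \<and> b \<in> lcs G i}
      \<subseteq> {g \<in> carrier G. M (\<sigma> g) - M g \<in> deg_ge (Suc (Suc i))}"
    proof clarify
      fix a b assume a: "a \<in> carrier G" and b: "b \<in> lcs G i"
      have bc: "b \<in> carrier G" using b by (rule lcs_closed)
      have c: "\<sigma> a \<in> carrier G" "\<sigma> b \<in> carrier G"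
        using a bc s by (auto simp: auto_closed basis_conj_auto)
      \<comment> \<open>Bracket as a named operation, so that \<open>algebra_simps\<close> can later
        treat it as a single ring element.\<close>
      define br where "br = (\<lambda>f g :: magnus. f * g - g * f)"
      let ?A = "M a - 1" and ?B = "M b - 1" and ?A' = "M (\<sigma> a) - 1" and ?B' = "M (\<sigma> b) - 1"
      let ?u = "M (inv a) * M (inv b)" and ?u' = "M (inv (\<sigma> a)) * M (inv (\<sigma> b))"
      have A: "?A \<in> deg_ge 1" "?A' \<in> deg_ge 1" using a c by (auto simp: M_minus_one_deg)
      have B: "?B \<in> deg_ge i" "?B' \<in> deg_ge i"
        using b auto_lcs[OF basis_conj_auto[OF s] b] by (auto simp: lcs_eq_dim dim_def)
      have AA: "?A' - ?A \<in> deg_ge 2" using one[OF a] by simp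
      have BB: "?B' - ?B \<in> deg_ge (Suc i)" using step.IH b by simp
      have br1: "br ?A ?B \<in> deg_ge (1 + i)"
        unfolding br_def using A(1) B(1) by (rule deg_ge_bracket)
      \<comment> \<open>Bilinearity: the first entry changes in degree 2 against degree i, the
        second in degree i + 1 against degree 1. Both give i + 2.\<close>
      have "br ?A' ?B' - br ?A ?B
        = ((?A' - ?A) * ?B' - ?B' * (?A' - ?A)) + (?A * (?B' - ?B) - (?B' - ?B) * ?A)"
        by (simp add: br_def algebra_simps)
      also have "\<dots> \<in> deg_ge (Suc (Suc i))"
        using deg_ge_add[OF deg_ge_bracket[OF AA B(2)]] deg_ge_bracket[OF A(1) BB] by simp
      finally have br2: "br ?A' ?B' - br ?A ?B \<in> deg_ge (Suc (Suc i))" .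
      have "M (inv a \<otimes> inv b) - 1 \<in> deg_ge 1" "M (inv (\<sigma> a) \<otimes> inv (\<sigma> b)) - 1 \<in> deg_ge 1"
        using a bc c by (auto simp: M_minus_one_deg simp del: M_mult)
      then have uu: "?u' - ?u \<in> deg_ge 1"
        using deg_ge_diff[of "?u' - 1" 1 "?u - 1"] a bc c by simp
      have "M (\<sigma> (gcomm G a b)) - M (gcomm G a b) = br ?A' ?B' * ?u' - br ?A ?B * ?u"
        unfolding br_def gcomm_hom[OF is_group is_group hom a bc]
          M_gcomm[OF a bc, symmetric] M_gcomm[OF c, symmetric] by simp
      \<comment> \<open>The bracket alone has degree only i + 1; the missing degree comes from
        \<open>uu\<close>, as both units have constant term 1.\<close>
      also have "\<dots> = (br ?A' ?B' - br ?A ?B) * ?u' + br ?A ?B * (?u' - ?u)"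
        by (simp add: algebra_simps)
      also have "\<dots> \<in> deg_ge (Suc (Suc i))"
        using deg_ge_mult_right[OF br2] deg_ge_mult[OF br1 uu] by (simp add: deg_ge_add)
      finally show "gcomm G a b \<in> carrier G \<and> M (\<sigma> (gcomm G a b)) - M (gcomm G a b) \<in> deg_ge (Suc (Suc i))"
        using a bc by simp
    qed
    then have "lcs G (Suc i) \<subseteq> {g \<in> carrier G. M (\<sigma> g) - M g \<in> deg_ge (Suc (Suc i))}"
      using step.hyps generate_subgroup_incl[OF _ subgroup_M_fix[OF hom]] by (simp add: lcs_Suc)
    then show ?case by auto
  qed
  then show "\<sigma> \<in> andr_filt 1" using s by (simp add: andr_filt_iff basis_conj_auto)
qed

text \<open>Evaluating the commutator at k amounts to comparing \<sigma>\<tau> with \<tau>\<sigma>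
  at g, the image of k under \<sigma>^-1 \<tau>^-1. The difference is governed by the displacements
  of g under \<tau> and \<sigma>.\<close>

lemma gcomm_andr_filt:
  assumes s: "\<sigma> \<in> andr_filt 1" and t: "\<tau> \<in> andr_filt j"
  shows "gcomm (AutoGroup G) \<sigma> \<tau> \<in> andr_filt (Suc j)"
proof -
  let ?A = "AutoGroup G"
  interpret A: group ?A by (rule AutoGroup)
  have sa: "\<sigma> \<in> auto G" and ta: "\<tau> \<in> auto G" using s t by (auto simp: andr_filt_auto)
  note ia = AutoGroup_inv_closed[OF sa] AutoGroup_inv_closed[OF ta]
  have "M (gcomm ?A \<sigma> \<tau> k) - M k \<in> deg_ge (i + Suc j)" if i: "1 \<le> i" and k: "k \<in> lcs G i" for i k
  proof -
    define g where "g = (inv\<^bsub>?A\<^esub> \<sigma>) ((inv\<^bsub>?A\<^esub> \<tau>) k)"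
    have g: "g \<in> lcs G i" using k ia by (simp add: g_def auto_lcs)
    have gc: "g \<in> carrier G" "k \<in> carrier G" using g k by (auto simp: lcs_closed)
    have gk: "\<tau> (\<sigma> g) = k"
      using gc sa ta ia by (simp add: g_def AutoGroup_inv_apply auto_closed)
    have st: "gcomm ?A \<sigma> \<tau> k = \<sigma> (\<tau> g)"
      using gc sa ta ia
      by (simp add: gcomm_def g_def AutoGroup_mult_apply AutoGroup_mult_closed auto_closed)
    define u v where "u = \<tau> g \<otimes> inv g" and "v = \<sigma> g \<otimes> inv g"
    have u: "u \<in> lcs G (i + j)" and v: "v \<in> lcs G (i + 1)"
      using s t g i by (auto simp: u_def v_def andr_filt_def)
    have uv: "u \<in> carrier G" "v \<in> carrier G" using u v by (auto simp: lcs_closed)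
    have tg: "\<tau> g = u \<otimes> g" and sg: "\<sigma> g = v \<otimes> g"
      using gc sa ta by (auto simp: u_def v_def auto_closed m_assoc)
    \<comment> \<open>\<sigma>\<tau>g = \<sigma>(u) v g and \<tau>\<sigma>g = \<tau>(v) u g, so the
      two sides share the right factor g.\<close>
    have "\<sigma> (\<tau> g) = \<sigma> u \<otimes> (v \<otimes> g)" "k = \<tau> v \<otimes> (u \<otimes> g)"
      unfolding gk[symmetric] using uv gc sa ta tg sg by (simp_all add: auto_mult)
    then have "M (\<sigma> (\<tau> g)) - M k = M (\<sigma> u) * (M v * M g) - M (\<tau> v) * (M u * M g)"
      using uv gc sa ta by (simp add: auto_closed)
    also have "\<dots> = ((M (\<sigma> u) - M u) * M v
        + ((M u - 1) * (M v - 1) - (M v - 1) * (M u - 1)) - (M (\<tau> v) - M v) * M u) * M g"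
      by (simp add: algebra_simps)
    also have "\<dots> \<in> deg_ge (i + Suc j)"
    proof -
      have "M (\<sigma> u) - M u \<in> deg_ge (i + Suc j)" using andr_filt_D[OF s _ u] i by simp
      moreover have "M (\<tau> v) - M v \<in> deg_ge (i + Suc j)" using andr_filt_D[OF t _ v] by simp
      moreover have "M u - 1 \<in> deg_ge (i + j)" "M v - 1 \<in> deg_ge (i + 1)"
        using u v by (auto simp: lcs_eq_dim dim_def)
      then have "(M u - 1) * (M v - 1) - (M v - 1) * (M u - 1) \<in> deg_ge (i + Suc j)"
        \<comment> \<open>The bracket of u and v even has degree 2i + j + 1, which exceeds i + j +
          1.\<close>
        using deg_ge_antimono[OF _ deg_ge_bracket, of "i + Suc j" "i + j" "i + 1"] by simp
      ultimately show ?thesis by (simp add: deg_ge_mult_right deg_ge_diff deg_ge_add)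
    qed
    finally show ?thesis by (simp add: st)
  qed
  moreover have "gcomm ?A \<sigma> \<tau> \<in> auto G"
    using A.gcomm_closed[of \<sigma> \<tau>] sa ta by (simp add: carrier_AutoGroup)
  ultimately show ?thesis by (simp add: andr_filt_iff)
qed

abbreviation BasisConj :: "('a \<Rightarrow> 'a) monoid" where
  "BasisConj \<equiv> (AutoGroup G)\<lparr>carrier := basis_conj\<rparr>"

lemma group_BasisConj: "group BasisConj"
  by (rule subgroup.subgroup_is_group[OF subgroup_basis_conj AutoGroup])

text \<open>Induction on j: commutators with elements of \<A>_1 raise the filtration index by one,
  and \<open>basis_conj\<close> lies in \<A>_1.\<close>

lemma lcs_BasisConj_subset_andr_filt: "1 \<le> j \<Longrightarrow> lcs BasisConj j \<subseteq> basis_conj \<inter> andr_filt j"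
proof (induction j rule: dec_induct)
  case base
  show ?case using basis_conj_subset_andr_filt_one by simp
next
  case (step j)
  interpret A: group "AutoGroup G" by (rule AutoGroup)
  interpret B: group BasisConj by (rule group_BasisConj)
  have "{gcomm BasisConj a b | a b. a \<in> carrier BasisConj \<and> b \<in> lcs BasisConj j}
    \<subseteq> basis_conj \<inter> andr_filt (Suc j)"
  proof clarify
    fix a b assume ab: "a \<in> carrier BasisConj" "b \<in> lcs BasisConj j"
    then have "gcomm BasisConj a b \<in> basis_conj" using B.gcomm_closed[of a b] B.lcs_closed by simp
    moreover have "gcomm BasisConj a b = gcomm (AutoGroup G) a b"
      using A.gcomm_consistent[OF subgroup_basis_conj, of a b] ab step.IH by auto
    moreover have "gcomm (AutoGroup G) a b \<in> andr_filt (Suc j)"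
      using ab step.IH basis_conj_subset_andr_filt_one by (intro gcomm_andr_filt) auto
    ultimately show "gcomm BasisConj a b \<in> basis_conj \<inter> andr_filt (Suc j)" by simp
  qed
  moreover have "subgroup (basis_conj \<inter> andr_filt (Suc j)) BasisConj"
    by (rule A.subgroup_incl[OF A.subgroups_Inter_pair[OF subgroup_basis_conj subgroup_andr_filt] subgroup_basis_conj]) auto
  ultimately show ?case using step.hyps B.generate_subgroup_incl by (simp only: B.lcs_Suc)
qed

section \<open>The retraction killing one generator, and conjugation of a single generator\<close>

definition kill :: "nat \<Rightarrow> 'a \<Rightarrow> 'a" where
  "kill i = (SOME h. h \<in> hom G G \<and> (\<forall>k<n. h (x k) = (if k = i then \<one> else x k)))"

lemma kill_spec: "kill i \<in> hom G G \<and> (\<forall>k<n. kill i (x k) = (if k = i then \<one> else x k))"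
proof -
  have "\<exists>h \<in> hom G G. \<forall>k<n. h (x k) = (if k = i then \<one> else x k)"
    by (rule extension) (auto intro: x_commutes_conj)
  then have "\<exists>h. h \<in> hom G G \<and> (\<forall>k<n. h (x k) = (if k = i then \<one> else x k))" by (simp only: Bex_def)
  then show ?thesis unfolding kill_def by (rule someI_ex)
qed

lemma kill_hom: "kill i \<in> hom G G"
  and kill_x: "k < n \<Longrightarrow> kill i (x k) = (if k = i then \<one> else x k)"
  using kill_spec by auto

sublocale kill: group_hom G G "kill i" for i
  using kill_hom by unfold_locales

lemma kill_in_generate:
  assumes "g \<in> carrier G"
  shows "kill i g \<in> generate G (x ` ({..<n} - {i}))"
proof -
  have "kill i ` (x ` {..<n}) \<subseteq> generate G (x ` ({..<n} - {i}))"
    unfolding image_image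
  proof (rule image_subsetI)
    fix k assume k: "k \<in> {..<n}"
    show "kill i (x k) \<in> generate G (x ` ({..<n} - {i}))"
    proof (cases "k = i")
      case True
      then show ?thesis using k generate.one[of G] by (simp add: kill_x)
    next
      case False
      then have "x k \<in> generate G (x ` ({..<n} - {i}))" using k by (intro generate.incl) auto
      then show ?thesis using k False by (simp add: kill_x)
    qed
  qed
  moreover have "subgroup (generate G (x ` ({..<n} - {i}))) G" by (rule generate_is_subgroup) auto
  ultimately have "generate G (kill i ` (x ` {..<n})) \<subseteq> generate G (x ` ({..<n} - {i}))"
    by (rule generate_subgroup_incl)
  then show ?thesis using assms kill.generate_img[OF x_subset[OF le_refl], of i] generate_x by auto
qed

lemma kill_fix:
  assumes "g \<in> generate G (x ` ({..<n} - {i}))"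
  shows "kill i g = g"
proof -
  have "kill i g = id g"
    by (rule hom_eq_on_generate[OF is_group is_group kill_hom _ _ _ assms]) (auto simp: kill_x hom_def split: if_splits)
  then show ?thesis by simp
qed

text \<open>Modulo the normal closure of x_i, killing x_i is the identity. Normality handles
  products.\<close>

lemma mult_inv_kill_in_ncl:
  assumes i: "i < n" and g: "g \<in> carrier G"
  shows "g \<otimes> inv (kill i g) \<in> ncl i"
proof -
  interpret N: normal "ncl i" G using i by (rule ncl_normal)
  have "g \<in> generate G (x ` {..<n})" using g generate_x by simp
  then show ?thesis
  proof (induction rule: generate.induct)
    case one
    then show ?case by simp
  next
    case (incl h)
    then show ?case using i by (auto simp: kill_x x_in_ncl)
  next
    case (inv h)
    then show ?case using i by (auto simp: kill_x x_in_ncl)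
  next
    case (eng h1 h2)
    then have c: "h1 \<in> carrier G" "h2 \<in> carrier G" using generate_x by auto
    then have "h1 \<otimes> h2 \<otimes> inv (kill i (h1 \<otimes> h2))
        = (h1 \<otimes> (h2 \<otimes> inv (kill i h2)) \<otimes> inv h1) \<otimes> (h1 \<otimes> inv (kill i h1))"
      by (simp add: m_assoc inv_mult_group)
    moreover have "h1 \<otimes> (h2 \<otimes> inv (kill i h2)) \<otimes> inv h1 \<in> ncl i"
      using c eng by (intro N.inv_op_closed2)
    ultimately show ?case using eng by simp
  qed
qed

text \<open>g and \<open>kill i g\<close> differ by an element of \<open>ncl i\<close>, which
  centralizes x_i. Hence any conjugator of x_i may be replaced by one in the other
  generators.\<close>

lemma conj_kill:
  assumes i: "i < n" and g: "g \<in> carrier G"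
  shows "inv (kill i g) \<otimes> x i \<otimes> kill i g = inv g \<otimes> x i \<otimes> g"
proof -
  interpret N: normal "ncl i" G using i by (rule ncl_normal)
  define a where "a = g \<otimes> inv (kill i g)"
  have a: "a \<in> ncl i" "a \<in> carrier G"
    using mult_inv_kill_in_ncl[OF i g] g by (auto simp: a_def)
  have "x i \<otimes> a = a \<otimes> x i" using ncl_commute[OF i x_in_ncl[OF i] a(1)] .
  then have "inv a \<otimes> (x i \<otimes> a) = x i" using a i by simp
  moreover have "g = a \<otimes> kill i g" using g by (simp add: a_def m_assoc)
  then have "inv g \<otimes> x i \<otimes> g = inv (kill i g) \<otimes> (inv a \<otimes> (x i \<otimes> a)) \<otimes> kill i g"
    using a i g by (metis inv_mult_group m_assoc m_closed inv_closed kill.hom_closed x_closed)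
  ultimately show ?thesis by simp
qed

text \<open>Passing through \<open>kill i\<close> makes this a homomorphism in \<open>w\<close> on
  all of G, not only on the subgroup of the other generators. \<open>restrict\<close> supplies the
  extensionality that \<open>auto G\<close> demands.\<close>

definition conj_one :: "nat \<Rightarrow> 'a \<Rightarrow> 'a \<Rightarrow> 'a" where
  "conj_one i w = restrict (SOME h. h \<in> hom G G \<and>
    (\<forall>k<n. h (x k) = (if k = i then inv (kill i w) \<otimes> x i \<otimes> kill i w else x k))) (carrier G)"

text \<open>The universal property applies because the new image of x_i stays in the abelian normal
  subgroup \<open>ncl i\<close>, so it commutes with all its conjugates.\<close>

lemma conj_one_spec:
  assumes i: "i < n" and w: "w \<in> carrier G"
  shows "conj_one i w \<in> hom G G \<and>
    (\<forall>k<n. conj_one i w (x k) = (if k = i then inv (kill i w) \<otimes> x i \<otimes> kill i w else x k))"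
proof -
  let ?y = "\<lambda>k. if k = i then inv (kill i w) \<otimes> x i \<otimes> kill i w else x k"
  have "\<exists>h \<in> hom G G. \<forall>k<n. h (x k) = ?y k"
  proof (rule extension)
    fix k g assume k: "k < n" and g: "g \<in> carrier G"
    show "?y k \<otimes> (g \<otimes> ?y k \<otimes> inv g) = g \<otimes> ?y k \<otimes> inv g \<otimes> ?y k"
    proof (cases "k = i")
      case True
      interpret N: normal "ncl i" G using i by (rule ncl_normal)
      have "?y i \<in> ncl i" using w i by (simp add: N.inv_op_closed1 x_in_ncl)
      then show ?thesis
        using True ncl_commute[OF i, of "?y i" "g \<otimes> ?y i \<otimes> inv g"] g by (simp add: N.inv_op_closed2)
    next
      case False
      then show ?thesis using x_commutes_conj[OF k g] by simp
    qed
  next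
    show "?y k \<in> carrier G" if "k < n" for k using that w i by simp
  qed
  then have "\<exists>h. h \<in> hom G G \<and> (\<forall>k<n. h (x k) = ?y k)" by (simp only: Bex_def)
  from someI_ex[OF this] show ?thesis unfolding conj_one_def by (auto simp: hom_def Pi_def)
qed

lemma conj_one_hom: "i < n \<Longrightarrow> w \<in> carrier G \<Longrightarrow> conj_one i w \<in> hom G G"
  and conj_one_x: "i < n \<Longrightarrow> w \<in> carrier G \<Longrightarrow> k < n \<Longrightarrow>
    conj_one i w (x k) = (if k = i then inv (kill i w) \<otimes> x i \<otimes> kill i w else x k)"
  using conj_one_spec by auto

lemma conj_one_closed: "i < n \<Longrightarrow> w \<in> carrier G \<Longrightarrow> g \<in> carrier G \<Longrightarrow> conj_one i w g \<in> carrier G"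
  using conj_one_hom hom_in_carrier by metis

lemma conj_one_fix:
  assumes "i < n" "w \<in> carrier G" "g \<in> generate G (x ` ({..<n} - {i}))"
  shows "conj_one i w g = g"
proof -
  have "conj_one i w g = id g"
    by (rule hom_eq_on_generate[OF is_group is_group conj_one_hom[OF assms(1,2)] _ _ _ assms(3)])
      (use assms in \<open>auto simp: conj_one_x hom_def split: if_splits\<close>)
  then show ?thesis by simp
qed

text \<open>\<open>conj_one i w\<close> fixes \<open>kill i v\<close>, which avoids x_i. So x_i ends
  up conjugated by the product of \<open>kill i w\<close> and \<open>kill i v\<close> in this order,
  that is by \<open>kill i (w \<otimes> v)\<close>.\<close>

lemma conj_one_mult:
  assumes i: "i < n" and w: "w \<in> carrier G" and v: "v \<in> carrier G" and g: "g \<in> carrier G"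
  shows "conj_one i w (conj_one i v g) = conj_one i (w \<otimes> v) g"
proof -
  interpret W: group_hom G G "conj_one i w" using conj_one_hom[OF i w] by unfold_locales
  interpret V: group_hom G G "conj_one i v" using conj_one_hom[OF i v] by unfold_locales
  have "(conj_one i w \<circ> conj_one i v) g = conj_one i (w \<otimes> v) g"
  proof (rule hom_eq_on_generate[OF is_group is_group, where S = "x ` {..<n}"
        and ?h1.0 = "conj_one i w \<circ> conj_one i v" and ?h2.0 = "conj_one i (w \<otimes> v)"])
    show "conj_one i w \<circ> conj_one i v \<in> hom G G" by (rule homI) simp_all
    show "conj_one i (w \<otimes> v) \<in> hom G G" using i w v by (simp add: conj_one_hom)
    show "x ` {..<n} \<subseteq> carrier G" by auto
    show "g \<in> generate G (x ` {..<n})" using g generate_x by simp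
    fix s assume "s \<in> x ` {..<n}"
    then obtain k where k: "k < n" "s = x k" by auto
    have "conj_one i w (kill i v) = kill i v" using conj_one_fix[OF i w kill_in_generate[OF v]] .
    then show "(conj_one i w \<circ> conj_one i v) s = conj_one i (w \<otimes> v) s"
      using k i w v by (simp add: conj_one_x m_assoc inv_mult_group)
  qed
  then show ?thesis by simp
qed

lemma conj_one_one:
  assumes i: "i < n" and g: "g \<in> carrier G"
  shows "conj_one i \<one> g = g"
proof -
  have "conj_one i \<one> g = id g"
    by (rule hom_eq_on_generate[OF is_group is_group conj_one_hom[OF i one_closed] _ x_subset[OF le_refl]])
      (use i g in \<open>auto simp: conj_one_x hom_def generate_x\<close>)
  then show ?thesis by simp
qed

lemma conj_one_auto:
  assumes i: "i < n" and w: "w \<in> carrier G"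
  shows "conj_one i w \<in> auto G"
proof -
  have "conj_one i w (conj_one i (inv w) g) = g \<and> conj_one i (inv w) (conj_one i w g) = g"
    if "g \<in> carrier G" for g
    using conj_one_mult[OF i w inv_closed[OF w] that] conj_one_mult[OF i inv_closed[OF w] w that] w conj_one_one[OF i that] by simp
  then have "bij_betw (conj_one i w) (carrier G) (carrier G)"
    using i w
      by (intro bij_betw_byWitness[where f' = "conj_one i (inv w)"]) (auto simp: conj_one_closed)
  then show ?thesis
    using conj_one_hom[OF i w] by (simp add: auto_def Bij_def) (simp add: conj_one_def)
qed

lemma conj_one_basis_conj:
  assumes i: "i < n" and w: "w \<in> carrier G"
  shows "conj_one i w \<in> basis_conj"
  unfolding basis_conj_def
proof (intro CollectI conjI allI impI)
  fix k assume k: "k < n"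
  show "\<exists>g\<in>carrier G. conj_one i w (x k) = inv g \<otimes> x k \<otimes> g"
    by (rule bexI[of _ "if k = i then kill i w else \<one>"]) (use i w k in \<open>auto simp: conj_one_x\<close>)
qed (use assms in \<open>simp add: conj_one_auto\<close>)

text \<open>Combined with \<open>lcs_hom\<close>, this moves a conjugator in \<Gamma>_j(G) to an
  automorphism in the j-th lower central series term of \<open>BasisConj\<close>.\<close>

lemma conj_one_hom_BasisConj: "i < n \<Longrightarrow> conj_one i \<in> hom G BasisConj"
proof (rule homI)
  fix w v assume i: "i < n" and w: "w \<in> carrier G" and v: "v \<in> carrier G"
  show "conj_one i (w \<otimes> v) = conj_one i w \<otimes>\<^bsub>BasisConj\<^esub> conj_one i v"
    using i w v by (intro auto_eqI)
      (simp_all add: conj_one_auto AutoGroup_mult_closed AutoGroup_mult_apply conj_one_mult)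
qed (simp add: conj_one_basis_conj)

text \<open>Multiplying by \<open>M w\<close> turns the hypothesis into a bound on X_i M(w) - M(w)
  X_i. As w avoids x_i, the coefficient of a nonempty word l in \<open>M w\<close> reappears at X_i
  X_l, coming from the first term only.\<close>

lemma conj_x_dim:
  assumes i: "i < n" and w: "w \<in> generate G (x ` ({..<n} - {i}))"
    and d: "M (inv w \<otimes> x i \<otimes> w) - M (x i) \<in> deg_ge (Suc j)"
  shows "w \<in> dim j"
proof -
  have wc: "w \<in> carrier G" using generate_x_closed[OF _ w] by auto
  have "M w * (M (inv w \<otimes> x i \<otimes> w) - M (x i)) = mvar i * M w - M w * mvar i"
  proof -
    have "M w * (M (inv w \<otimes> x i \<otimes> w) - M (x i))
      = (M w * M (inv w)) * ((1 + mvar i) * M w) - M w * (1 + mvar i)"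
      using wc i by (simp add: right_diff_distrib mult.assoc del: M_inv_right)
    then show ?thesis using wc by (simp add: algebra_simps)
  qed
  then have br: "mvar i * M w - M w * mvar i \<in> deg_ge (Suc j)"
    using deg_ge_mult_left[OF d, of "M w"] by simp
  have over: "M w \<in> over_vars ({..<n} - {i})" by (rule M_over_vars[OF _ w]) auto
  have "mcoeff (M w - 1) l = 0" if l: "length l < j" for l
  proof (cases "distinct (i # l)")
    case False
    then consider "\<not> distinct l" | "i \<in> set l" by auto
    then show ?thesis
    proof cases
      case 1
      then show ?thesis by (rule mcoeff_not_distinct)
    next
      case 2
      then have "mcoeff (M w) l = 0" using over by (auto simp: over_vars_def)
      then show ?thesis using 2 by auto
    qed
  next
    case True
    show ?thesis
    proof (cases l rule: rev_cases)
      case Nil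
      \<comment> \<open>The bracket says nothing here, as both terms contribute to X_i; but
        \<open>M w\<close> has constant term 1.\<close>
      then show ?thesis using M_minus_one_deg[OF wc] by (simp add: deg_ge_def del: mcoeff_simps)
    next
      case (snoc l' b)
      have "mcoeff (mvar i * M w - M w * mvar i) (i # l) = 0"
        using br l by (simp add: deg_ge_def del: mcoeff_simps)
      moreover have "mcoeff (mvar i * M w) (i # l) = mcoeff (M w) l"
        using mcoeff_mvar_mult[OF True, of i "M w"] by simp
      moreover have "mcoeff (M w * mvar i) (i # l) = 0"
        \<comment> \<open>The word i # l ends in b, and b differs from i by distinctness.\<close>
        using mcoeff_mult_mvar[of "i # l'" b "M w" i] True snoc by auto
      ultimately show ?thesis using snoc by simp
    qed
  qed
  then show ?thesis using wc by (simp add: dim_def deg_ge_def del: mcoeff_simps)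
qed

text \<open>\<open>m\<close> counts the generators already fixed to one degree more. The induction
  runs down from m = n, where \<open>next_step\<close> applies; each step divides by one
  \<open>conj_one m w\<close> to improve x_m without disturbing the others.\<close>

lemma basis_conj_in_lcs_step:
  assumes j: "1 \<le> j"
    and next_step: "\<And>\<sigma>. \<sigma> \<in> basis_conj \<Longrightarrow>
      (\<And>i. i < n \<Longrightarrow> M (\<sigma> (x i)) - M (x i) \<in> deg_ge (Suc (Suc j))) \<Longrightarrow> \<sigma> \<in> lcs BasisConj j"
  shows "m \<le> n \<Longrightarrow> \<sigma> \<in> basis_conj \<Longrightarrow> (\<And>i. i < n \<Longrightarrow> M (\<sigma> (x i)) - M (x i) \<in> deg_ge (Suc j)) \<Longrightarrow>
      (\<And>i. i < m \<Longrightarrow> M (\<sigma> (x i)) - M (x i) \<in> deg_ge (Suc (Suc j))) \<Longrightarrow> \<sigma> \<in> lcs BasisConj j"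
proof (induction m arbitrary: \<sigma> rule: inc_induct)
  case base
  then show ?case using next_step by blast
next
  case (step m)
  interpret B: group BasisConj by (rule group_BasisConj)
  interpret Lj: subgroup "lcs BasisConj j" BasisConj by (rule B.subgroup_lcs)
  note m = \<open>m < n\<close> and s = step.prems(1)
  note sa = basis_conj_auto[OF s]
  obtain g where g: "g \<in> carrier G" "\<sigma> (x m) = inv g \<otimes> x m \<otimes> g"
    using s m unfolding basis_conj_def by blast
  define w where "w = kill m g"
  have wgen: "w \<in> generate G (x ` ({..<n} - {m}))"
    using kill_in_generate[OF g(1)] by (simp add: w_def)
  have wc: "w \<in> carrier G" using g by (simp add: w_def)
  have rw: "kill m w = w" using wgen by (rule kill_fix)
  have sm: "\<sigma> (x m) = inv w \<otimes> x m \<otimes> w" using conj_kill[OF m g(1)] g(2) by (simp add: w_def)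
  have "w \<in> dim j" by (rule conj_x_dim[OF m wgen]) (use step.prems(2)[OF m] sm in simp)
  then have wl: "w \<in> lcs G j" by (simp add: lcs_eq_dim)
  have chiw: "conj_one m w \<in> lcs BasisConj j"
    by (rule lcs_hom[OF is_group group_BasisConj conj_one_hom_BasisConj[OF m] wl])
  define \<tau> where "\<tau> = \<sigma> \<otimes>\<^bsub>BasisConj\<^esub> conj_one m (inv w)"
  have t: "\<tau> \<in> basis_conj"
    using B.m_closed[of \<sigma> "conj_one m (inv w)"] s conj_one_basis_conj[OF m, of "inv w"] wc
      by (simp add: \<tau>_def)
  have tx: "\<tau> g = \<sigma> (conj_one m (inv w) g)" if "g \<in> carrier G" for g
    using that sa m wc by (simp add: \<tau>_def AutoGroup_mult_apply conj_one_auto)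
  have tother: "\<tau> (x i) = \<sigma> (x i)" if "i < n" "i \<noteq> m" for i
    using that m wc by (simp add: tx conj_one_x)
  \<comment> \<open>After the division x_m is still conjugated, but only by w
    \<sigma>(w)^-1.\<close>
  define p where "p = w \<otimes> inv (\<sigma> w)"
  have sw: "\<sigma> w \<in> carrier G" and p: "p \<in> carrier G" using wc sa by (auto simp: p_def auto_closed)
  have "\<tau> (x m) = \<sigma> (w \<otimes> x m \<otimes> inv w)"
    using m wc rw by (simp add: tx conj_one_x)
  also have "\<dots> = \<sigma> w \<otimes> (inv w \<otimes> x m \<otimes> w) \<otimes> inv (\<sigma> w)"
    using sa wc m sm by (simp add: auto_mult auto_inv)
  also have "\<dots> = inv p \<otimes> x m \<otimes> p"
    using sw wc m by (simp add: p_def m_assoc inv_mult_group)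
  finally have tm: "\<tau> (x m) = inv p \<otimes> x m \<otimes> p" .
  \<comment> \<open>Since \<sigma> is in \<A>_1 and w in \<Gamma>_j, p has one degree more than w;
    bracketing with x_m - 1 adds another.\<close>
  have "M (\<sigma> w) - M w \<in> deg_ge (j + 1)"
    using andr_filt_D[of \<sigma> 1 j w] s basis_conj_subset_andr_filt_one j wl by blast
  then have "M w - M (\<sigma> w) \<in> deg_ge (Suc j)" using deg_ge_uminus by fastforce
  then have "p \<in> dim (Suc j)" using wc sw by (simp add: p_def mult_inv_in_dim_iff)
  then have "M p - 1 \<in> deg_ge (Suc j)" by (simp add: dim_def)
  from deg_ge_bracket[OF M_minus_one_deg this, of "x m"]
  have "M (\<tau> (x m)) - M (x m) \<in> deg_ge (Suc (Suc j))"
    unfolding tm M_conj_minus[OF x_closed[OF m] p]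
      using m by (intro deg_ge_mult_left) (simp del: M_x)
  note tm' = this
  have "\<tau> \<in> lcs BasisConj j"
  proof (rule step.IH[OF t])
    fix i assume "i < n"
    then show "M (\<tau> (x i)) - M (x i) \<in> deg_ge (Suc j)"
      using tother[of i] step.prems(2)[of i] tm' deg_ge_antimono[of "Suc j" "Suc (Suc j)"]
        by (cases "i = m") auto
  next
    fix i assume "i < Suc m"
    then show "M (\<tau> (x i)) - M (x i) \<in> deg_ge (Suc (Suc j))"
      using tother[of i] step.prems(3)[of i] tm' m by (cases "i = m") auto
  qed
  then have "\<tau> \<otimes>\<^bsub>BasisConj\<^esub> conj_one m w \<in> lcs BasisConj j" using chiw by (rule Lj.m_closed)
  moreover have "\<sigma> = \<tau> \<otimes>\<^bsub>BasisConj\<^esub> conj_one m w"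
  proof (rule auto_eqI[OF sa])
    show "\<tau> \<otimes>\<^bsub>BasisConj\<^esub> conj_one m w \<in> auto G"
      using basis_conj_auto[OF t] conj_one_auto[OF m wc] by (simp add: AutoGroup_mult_closed)
    fix g assume g: "g \<in> carrier G"
    have "(\<tau> \<otimes>\<^bsub>BasisConj\<^esub> conj_one m w) g = \<tau> (conj_one m w g)"
      using basis_conj_auto[OF t] conj_one_auto[OF m wc] g by (simp add: AutoGroup_mult_apply)
    also have "\<dots> = \<sigma> g"
      using g m wc by (simp add: tx conj_one_closed conj_one_mult conj_one_one)
    finally show "\<sigma> g = (\<tau> \<otimes>\<^bsub>BasisConj\<^esub> conj_one m w) g" by simp
  qed
  ultimately show ?case by (simp only:)
qed

text \<open>Descending induction on j. Once j \<ge> n, \<Gamma>_(j+1) is trivial, so \<sigma> fixes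
  every generator and is the identity. Below that, the result for j + 1 supplies
  \<open>next_step\<close>.\<close>

lemma basis_conj_in_lcs:
  "1 \<le> j \<Longrightarrow> \<sigma> \<in> basis_conj \<Longrightarrow> (\<And>i. i < n \<Longrightarrow> M (\<sigma> (x i)) - M (x i) \<in> deg_ge (Suc j)) \<Longrightarrow>
    \<sigma> \<in> lcs BasisConj j"
proof (induction "n - j" arbitrary: j \<sigma>)
  case 0
  interpret B: group BasisConj by (rule group_BasisConj)
  have "\<sigma> (x i) = x i" if i: "i < n" for i
  proof -
    have c: "\<sigma> (x i) \<in> carrier G" using 0 i by (simp add: auto_closed basis_conj_auto)
    then have "\<sigma> (x i) \<otimes> inv (x i) \<in> lcs G (Suc j)"
      using 0 i by (simp add: lcs_eq_dim mult_inv_in_dim_iff del: M_x)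
    then have "\<sigma> (x i) \<otimes> inv (x i) = \<one>" using lcs_trivial[of "Suc j"] 0 by auto
    then show ?thesis using c i by (metis inv_closed inv_equality inv_inv x_closed)
  qed
  then have fix_gens: "\<sigma> s = s" if "s \<in> x ` {..<n}" for s using that by auto
  have "(\<lambda>g. g) \<in> hom G G" by (simp add: hom_def)
  then have "\<sigma> g = g" if "g \<in> generate G (x ` {..<n})" for g
    using hom_eq_on_generate[OF is_group is_group auto_hom[OF basis_conj_auto[OF 0(3)]] _ x_subset[OF le_refl] fix_gens that]
    by simp
  then have "\<sigma> g = g" if "g \<in> carrier G" for g using that by (simp add: generate_x)
  then have "\<sigma> = \<one>\<^bsub>BasisConj\<^esub>"
    using auto_eqI[OF basis_conj_auto[OF 0(3)], of "\<one>\<^bsub>BasisConj\<^esub>"] basis_conj_auto[of "\<one>\<^bsub>BasisConj\<^esub>"] B.one_closed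
    by (simp add: AutoGroup_one_apply)
  then show ?case using subgroup.one_closed[OF B.subgroup_lcs] by simp
next
  case (Suc d)
  interpret B: group BasisConj by (rule group_BasisConj)
  show ?case
  \<comment> \<open>Started at m = 0, where no generator has been improved yet.\<close>
  proof (rule basis_conj_in_lcs_step[OF Suc.prems(1) _ le0 Suc.prems(2,3)])
    fix \<tau> assume "\<tau> \<in> basis_conj" "\<And>i. i < n \<Longrightarrow> M (\<tau> (x i)) - M (x i) \<in> deg_ge (Suc (Suc j))"
    then have "\<tau> \<in> lcs BasisConj (Suc j)" using Suc.hyps(2) by (intro Suc.hyps(1)) auto
    then show "\<tau> \<in> lcs BasisConj j" using B.lcs_antimono by blast
  qed auto
qed

theorem lcs_BasisConj_eq: "1 \<le> j \<Longrightarrow> lcs BasisConj j = basis_conj \<inter> andr_filt j"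
proof
  assume j: "1 \<le> j"
  show "lcs BasisConj j \<subseteq> basis_conj \<inter> andr_filt j" using j by (rule lcs_BasisConj_subset_andr_filt)
  show "basis_conj \<inter> andr_filt j \<subseteq> lcs BasisConj j"
  proof
    fix \<sigma> assume "\<sigma> \<in> basis_conj \<inter> andr_filt j"
    then show "\<sigma> \<in> lcs BasisConj j"
      using j andr_filt_D[of \<sigma> j 1] by (intro basis_conj_in_lcs) (auto simp del: M_x)
  qed
qed

end

section \<open>Presentation by words\<close>

lemma rf_eq_append: "rf_eq n u u' \<Longrightarrow> rf_eq n v v' \<Longrightarrow> rf_eq n (u @ v) (u' @ v')"
  using rf_eq.ctx[of n u u' "[]" v] rf_eq.ctx[of n v v' u' "[]"] rf_eq.trans by fastforce

lemma winv_simps [simp]: "winv [] = []" "winv ((i, e) # w) = winv w @ [(i, \<not> e)]"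
  by (simp_all add: winv_def)

lemma winv_winv: "winv (winv w) = w"
  by (simp add: winv_def rev_map comp_def case_prod_unfold)

lemma rf_eq_winv_left: "rf_eq n (winv w @ w) []"
proof (induction w)
  case (Cons l w)
  obtain i e where l: "l = (i, e)" by (cases l)
  have "rf_eq n (winv w @ [(i, \<not> e), (i, e)] @ w) (winv w @ [] @ w)"
    using rf_eq.cancel[of n i "\<not> e"] by (intro rf_eq.ctx) simp
  then show ?case using Cons l rf_eq.trans by simp
qed (simp add: rf_eq.refl)

lemma words_simps [simp]: "[] \<in> words n" "u @ v \<in> words n \<longleftrightarrow> u \<in> words n \<and> v \<in> words n"
  "(i, e) # w \<in> words n \<longleftrightarrow> i < n \<and> w \<in> words n" "winv w \<in> words n \<longleftrightarrow> w \<in> words n"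
  by (auto simp: words_def letters_def winv_def in_lists_conv_set split: prod.splits)

lemma rf_class_eq_iff:
  "u \<in> words n \<Longrightarrow> v \<in> words n \<Longrightarrow> rf_class n u = rf_class n v \<longleftrightarrow> rf_eq n u v"
  unfolding rf_class_def using rf_eq.refl rf_eq.sym rf_eq.trans by blast

lemma some_in_rf_class:
  assumes "w \<in> words n"
  shows "(SOME a. a \<in> rf_class n w) \<in> words n" "rf_eq n w (SOME a. a \<in> rf_class n w)"
proof -
  have "w \<in> rf_class n w" using assms by (simp add: rf_class_def rf_eq.refl)
  then have "(SOME a. a \<in> rf_class n w) \<in> rf_class n w" by (rule someI)
  then show "(SOME a. a \<in> rf_class n w) \<in> words n" "rf_eq n w (SOME a. a \<in> rf_class n w)"
    by (auto simp: rf_class_def)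
qed

lemma RF_carrier: "carrier (RF n) = rf_class n ` words n"
  and RF_one: "\<one>\<^bsub>RF n\<^esub> = rf_class n []"
  by (simp_all add: RF_def)

text \<open>\<open>rf_eq\<close> is a congruence, so the representatives picked by
  \<open>SOME\<close> do not matter.\<close>

lemma RF_mult:
  assumes "u \<in> words n" "v \<in> words n"
  shows "rf_class n u \<otimes>\<^bsub>RF n\<^esub> rf_class n v = rf_class n (u @ v)"
proof -
  let ?u = "SOME a. a \<in> rf_class n u" and ?v = "SOME a. a \<in> rf_class n v"
  have "rf_eq n (u @ v) (?u @ ?v)" using assms some_in_rf_class by (intro rf_eq_append) auto
  then have "rf_class n (u @ v) = rf_class n (?u @ ?v)"
    using assms some_in_rf_class by (subst rf_class_eq_iff) auto
  then show ?thesis by (simp add: RF_def)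
qed

lemma group_RF: "group (RF n)"
proof (rule groupI)
  fix a assume "a \<in> carrier (RF n)"
  then obtain w where w: "w \<in> words n" "a = rf_class n w" by (auto simp: RF_carrier)
  then show "\<one>\<^bsub>RF n\<^esub> \<otimes>\<^bsub>RF n\<^esub> a = a" by (simp add: RF_one RF_mult)
  have "rf_class n (winv w) \<otimes>\<^bsub>RF n\<^esub> a = \<one>\<^bsub>RF n\<^esub>"
    using w by (simp add: RF_mult RF_one rf_class_eq_iff rf_eq_winv_left)
  then show "\<exists>b\<in>carrier (RF n). b \<otimes>\<^bsub>RF n\<^esub> a = \<one>\<^bsub>RF n\<^esub>"
    using w by (auto simp: RF_carrier)
qed (auto simp: RF_carrier RF_one RF_mult)

lemma RF_inv: "w \<in> words n \<Longrightarrow> inv\<^bsub>RF n\<^esub> rf_class n w = rf_class n (winv w)"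
  by (rule group.inv_equality[OF group_RF])
    (auto simp: RF_mult RF_one rf_class_eq_iff rf_eq_winv_left RF_carrier)

lemma gen_closed: "i < n \<Longrightarrow> gen n i \<in> carrier (RF n)"
  by (simp add: gen_def RF_carrier)

lemma generate_gen: "generate (RF n) (gen n ` {..<n}) = carrier (RF n)"
proof
  interpret group "RF n" by (rule group_RF)
  show "generate (RF n) (gen n ` {..<n}) \<subseteq> carrier (RF n)"
    by (rule generate_incl) (auto simp: gen_closed)
  have "w \<in> words n \<Longrightarrow> rf_class n w \<in> generate (RF n) (gen n ` {..<n})" for w
  proof (induction w)
    case Nil
    then show ?case using generate.one[of "RF n"] by (simp add: RF_one)
  next
    case (Cons l w)
    obtain i e where l: "l = (i, e)" by (cases l)
    then have i: "i < n" and w: "w \<in> words n" using Cons.prems by auto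
    have "rf_class n [(i, e)] = (if e then inv\<^bsub>RF n\<^esub> gen n i else gen n i)"
      using i by (simp add: gen_def RF_inv)
    moreover have "gen n i \<in> gen n ` {..<n}" using i by simp
    ultimately have "rf_class n [(i, e)] \<in> generate (RF n) (gen n ` {..<n})"
      using generate.incl[of "gen n i" _ "RF n"] generate.inv[of "gen n i" _ "RF n"] by simp
    from generate.eng[OF this Cons.IH[OF w]] show ?case using i w l by (simp add: RF_mult)
  qed
  then show "carrier (RF n) \<subseteq> generate (RF n) (gen n ` {..<n})" by (auto simp: RF_carrier)
qed

section \<open>The universal property of the reduced free group\<close>

fun word_eval :: "('a, 'b) monoid_scheme \<Rightarrow> (nat \<Rightarrow> 'a) \<Rightarrow> word \<Rightarrow> 'a" where
  "word_eval H y [] = \<one>\<^bsub>H\<^esub>"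
| "word_eval H y ((i, e) # w) = (if e then inv\<^bsub>H\<^esub> y i else y i) \<otimes>\<^bsub>H\<^esub> word_eval H y w"

context group
begin

context
  fixes y :: "nat \<Rightarrow> 'a"
  assumes y_closed [simp]: "\<And>i. y i \<in> carrier G"
begin

lemma word_eval_closed [simp]: "word_eval G y w \<in> carrier G"
  by (induction w) auto

lemma word_eval_append: "word_eval G y (u @ v) = word_eval G y u \<otimes> word_eval G y v"
  by (induction u) (auto simp: m_assoc)

lemma word_eval_winv: "word_eval G y (winv w) = inv (word_eval G y w)"
  by (induction w) (auto simp: word_eval_append inv_mult_group)

text \<open>\<open>rf_eq\<close> also relates words with letters beyond n, which is why
  \<open>y\<close> takes values in G at every index; relators involve only i < n.\<close>

lemma word_eval_rf_eq:
  assumes comm: "\<And>i g. i < n \<Longrightarrow> g \<in> carrier G \<Longrightarrow>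
      y i \<otimes> (g \<otimes> y i \<otimes> inv g) = (g \<otimes> y i \<otimes> inv g) \<otimes> y i"
  shows "rf_eq n u v \<Longrightarrow> word_eval G y u = word_eval G y v"
proof (induction rule: rf_eq.induct)
  case (rel r)
  then obtain i w where i: "i < n" and r: "r = wcomm [(i, False)] (wconj [(i, False)] w)"
    by (auto simp: rf_relators_def)
  \<comment> \<open>\<open>wconj\<close> conjugates as w^-1 x w, while \<open>comm\<close> speaks of
    g y g^-1.\<close>
  define g where "g = inv (word_eval G y w)"
  define c where "c = g \<otimes> y i \<otimes> inv g"
  have g: "g \<in> carrier G" "inv g = word_eval G y w" by (auto simp: g_def)
  have c: "c \<in> carrier G" using g by (simp add: c_def)
  have "word_eval G y (wconj [(i, False)] w) = c"
    using g by (simp add: wconj_def word_eval_append word_eval_winv c_def g_def m_assoc)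
  then have "word_eval G y r = y i \<otimes> c \<otimes> inv (y i) \<otimes> inv c"
    unfolding r wcomm_def word_eval_append word_eval_winv by (simp add: m_assoc c)
  also have "y i \<otimes> c = c \<otimes> y i" using comm[OF i g(1)] by (simp add: c_def)
  finally show ?case using c by (simp add: m_assoc)
next
  case (cancel i e)
  then show ?case by (cases e) auto
qed (auto simp: word_eval_append)

text \<open>Applied to the unit group of the Magnus ring to obtain \<open>M\<close>, and to
  \<open>RF n\<close> itself to obtain endomorphisms.\<close>

lemma RF_extension:
  assumes comm: "\<And>i g. i < n \<Longrightarrow> g \<in> carrier G \<Longrightarrow>
      y i \<otimes> (g \<otimes> y i \<otimes> inv g) = (g \<otimes> y i \<otimes> inv g) \<otimes> y i"
  shows "\<exists>h \<in> hom (RF n) G. \<forall>i<n. h (gen n i) = y i"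
proof
  let ?h = "\<lambda>A. word_eval G y (SOME a. a \<in> A)"
  have h: "?h (rf_class n w) = word_eval G y w" if "w \<in> words n" for w
    using word_eval_rf_eq[OF comm some_in_rf_class(2)[OF that]] by simp
  show "?h \<in> hom (RF n) G"
  proof (rule homI)
    fix a b assume "a \<in> carrier (RF n)" "b \<in> carrier (RF n)"
    then obtain u v where "u \<in> words n" "a = rf_class n u" "v \<in> words n" "b = rf_class n v"
      by (auto simp: RF_carrier)
    then show "?h (a \<otimes>\<^bsub>RF n\<^esub> b) = ?h a \<otimes> ?h b"
      by (simp only: RF_mult h words_simps word_eval_append simp_thms)
  qed simp
  show "\<forall>i<n. ?h (gen n i) = y i"
    by (simp add: gen_def h)
qed

end

end

lemma gen_commutes_conj:
  assumes "i < n" "g \<in> carrier (RF n)"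
  shows "gen n i \<otimes>\<^bsub>RF n\<^esub> (g \<otimes>\<^bsub>RF n\<^esub> gen n i \<otimes>\<^bsub>RF n\<^esub> inv\<^bsub>RF n\<^esub> g)
    = (g \<otimes>\<^bsub>RF n\<^esub> gen n i \<otimes>\<^bsub>RF n\<^esub> inv\<^bsub>RF n\<^esub> g) \<otimes>\<^bsub>RF n\<^esub> gen n i"
proof -
  interpret group "RF n" by (rule group_RF)
  obtain w where w: "w \<in> words n" "g = rf_class n w" using assms by (auto simp: RF_carrier)
  \<comment> \<open>The inverse word appears because relators use w^-1 x w instead of w x
    w^-1.\<close>
  let ?x = "[(i, False)]" and ?c = "wconj [(i, False)] (winv w)"
  have c: "?c \<in> words n" using w assms by (simp add: wconj_def)
  have gc: "g \<otimes>\<^bsub>RF n\<^esub> gen n i \<otimes>\<^bsub>RF n\<^esub> inv\<^bsub>RF n\<^esub> g = rf_class n ?c"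
    using w assms by (simp add: gen_def RF_inv RF_mult wconj_def winv_winv)
  have "wcomm ?x ?c \<in> rf_relators n"
    unfolding rf_relators_def using assms w by (auto intro!: exI[of _ i] exI[of _ "winv w"])
  then have "rf_class n (wcomm ?x ?c) = \<one>\<^bsub>RF n\<^esub>"
    using c assms by (simp add: rf_class_eq_iff RF_one wcomm_def rf_eq.rel)
  moreover have "rf_class n (wcomm ?x ?c) = gen n i \<otimes>\<^bsub>RF n\<^esub> rf_class n ?c
      \<otimes>\<^bsub>RF n\<^esub> inv\<^bsub>RF n\<^esub> gen n i \<otimes>\<^bsub>RF n\<^esub> inv\<^bsub>RF n\<^esub> rf_class n ?c"
    using c assms by (simp add: wcomm_def gen_def RF_inv RF_mult)
  moreover have cc: "rf_class n ?c \<in> carrier (RF n)" "gen n i \<in> carrier (RF n)"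
    using c gen_closed[OF assms(1)] by (simp_all add: RF_carrier)
  ultimately have "gen n i \<otimes>\<^bsub>RF n\<^esub> rf_class n ?c \<otimes>\<^bsub>RF n\<^esub>
      inv\<^bsub>RF n\<^esub> gen n i = rf_class n ?c"
    by (metis inv_closed inv_equality inv_inv m_closed)
  then have "gen n i \<otimes>\<^bsub>RF n\<^esub> rf_class n ?c = rf_class n ?c \<otimes>\<^bsub>RF n\<^esub> gen n i"
    using cc inv_solve_right'[of "rf_class n ?c" "gen n i \<otimes>\<^bsub>RF n\<^esub> rf_class n ?c" "gen n i"] by simp
  then show ?thesis unfolding gc .
qed

section \<open>Existence of the Magnus representation\<close>

definition magnus_units :: "magnus monoid" where
  "magnus_units = \<lparr>carrier = {f. \<exists>g. f * g = 1 \<and> g * f = 1}, monoid.mult = (*), monoid.one = 1\<rparr>"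

lemma magnus_units_simps:
  "carrier magnus_units = {f. \<exists>g. f * g = 1 \<and> g * f = 1}"
  "f \<otimes>\<^bsub>magnus_units\<^esub> g = f * g" "\<one>\<^bsub>magnus_units\<^esub> = 1"
  by (simp_all add: magnus_units_def)

lemma group_magnus_units: "group magnus_units"
proof (rule groupI, unfold magnus_units_simps)
  fix f g :: magnus
  assume "f \<in> {f. \<exists>g. f * g = 1 \<and> g * f = 1}" "g \<in> {f. \<exists>g. f * g = 1 \<and> g * f = 1}"
  then obtain f' g' where "f * f' = 1" "f' * f = 1" "g * g' = 1" "g' * g = 1" by auto
  then have "(f * g) * (g' * f') = 1" "(g' * f') * (f * g) = 1"
    by (metis mult.assoc mult_1_right)+
  then show "f * g \<in> {f. \<exists>g. f * g = 1 \<and> g * f = 1}" by blast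
qed (auto simp: mult.assoc)

lemma mvar_unit: "(1 + mvar i) * (1 - mvar i) = 1" "(1 - mvar i) * (1 + mvar i) = 1"
  by (simp_all add: algebra_simps mvar_square)

text \<open>The relations hold because X_i times a conjugate of X_i, in either order, contains X_i
  twice; so 1 + X_i commutes with its conjugates.\<close>

lemma ex_magnus_rep:
  "\<exists>M. M \<one>\<^bsub>RF n\<^esub> = 1 \<and> (\<forall>g \<in> carrier (RF n). \<forall>h \<in> carrier (RF n). M (g \<otimes>\<^bsub>RF n\<^esub> h) = M g * M h)
    \<and> (\<forall>i<n. M (gen n i) = 1 + mvar i)"
proof -
  interpret U: group magnus_units by (rule group_magnus_units)
  have y: "1 + mvar i \<in> carrier magnus_units" for i
    using mvar_unit by (auto simp: magnus_units_simps)
  have "\<exists>h \<in> hom (RF n) magnus_units. \<forall>i<n. h (gen n i) = 1 + mvar i"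
  proof (rule U.RF_extension[OF y])
    fix i g assume g: "g \<in> carrier magnus_units"
    have g': "g * inv\<^bsub>magnus_units\<^esub> g = 1"
      using U.r_inv[OF g] by (simp add: magnus_units_simps)
    let ?g' = "inv\<^bsub>magnus_units\<^esub> g"
    have conj: "g * (1 + mvar i) * ?g' = 1 + g * mvar i * ?g'"
      using g' by (simp add: algebra_simps)
    have "mvar i * (g * mvar i * ?g') = 0" "g * mvar i * ?g' * mvar i = 0"
      by (intro with_var_mult_with_var[of _ i] mvar_with_var with_var_mult_right with_var_mult_left)+
    then show "(1 + mvar i) \<otimes>\<^bsub>magnus_units\<^esub> (g \<otimes>\<^bsub>magnus_units\<^esub> (1 + mvar i) \<otimes>\<^bsub>magnus_units\<^esub> ?g') =
        g \<otimes>\<^bsub>magnus_units\<^esub> (1 + mvar i) \<otimes>\<^bsub>magnus_units\<^esub> ?g' \<otimes>\<^bsub>magnus_units\<^esub> (1 + mvar i)"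
      unfolding magnus_units_simps conj
        by (simp only: distrib_left distrib_right mult_1_left mult_1_right ac_simps)
  qed
  then obtain M where M: "M \<in> hom (RF n) magnus_units" "\<forall>i<n. M (gen n i) = 1 + mvar i" by blast
  have "M \<one>\<^bsub>RF n\<^esub> = 1"
    using hom_one[OF M(1) group_RF group_magnus_units] by (simp add: magnus_units_simps)
  then show ?thesis using M hom_mult[OF M(1)] by (auto simp: magnus_units_simps)
qed

theorem theorem4p9:
  fixes n j :: nat
  assumes "n \<ge> 2" and "j \<ge> 1"
  shows "lcs (hPSigma_grp n) j = hPSigma n \<inter> andreadakis n j"
proof -
  obtain M where M: "M \<one>\<^bsub>RF n\<^esub> = 1"
    "\<forall>g \<in> carrier (RF n). \<forall>h \<in> carrier (RF n). M (g \<otimes>\<^bsub>RF n\<^esub> h) = M g * M h"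
    "\<forall>i<n. M (gen n i) = 1 + mvar i"
    using ex_magnus_rep by blast
  interpret RF: group "RF n" by (rule group_RF)
  interpret RF: reduced_free_group "RF n" n "gen n" M
  proof
    fix y :: "nat \<Rightarrow> word set"
    assume y: "\<And>i. i < n \<Longrightarrow> y i \<in> carrier (RF n)"
      and comm: "\<And>i g. i < n \<Longrightarrow> g \<in> carrier (RF n) \<Longrightarrow>
        y i \<otimes>\<^bsub>RF n\<^esub> (g \<otimes>\<^bsub>RF n\<^esub> y i \<otimes>\<^bsub>RF n\<^esub> inv\<^bsub>RF n\<^esub> g) =
        (g \<otimes>\<^bsub>RF n\<^esub> y i \<otimes>\<^bsub>RF n\<^esub> inv\<^bsub>RF n\<^esub> g) \<otimes>\<^bsub>RF n\<^esub> y i"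
    \<comment> \<open>Padded with 1 beyond n, since \<open>RF_extension\<close> wants a value at
      every index.\<close>
    let ?y = "\<lambda>i. if i < n then y i else \<one>\<^bsub>RF n\<^esub>"
    have "\<exists>h \<in> hom (RF n) (RF n). \<forall>i<n. h (gen n i) = ?y i"
      by (rule RF.RF_extension) (use y comm in auto)
    then show "\<exists>h \<in> hom (RF n) (RF n). \<forall>i<n. h (gen n i) = y i" by simp
  qed (use M in \<open>simp_all add: gen_closed generate_gen gen_commutes_conj\<close>)
  have "RF.basis_conj = hPSigma n" "RF.andr_filt j = andreadakis n j"
    by (simp_all add: RF.basis_conj_def RF.andr_filt_def hPSigma_def andreadakis_def)
  then show ?thesis
    using RF.lcs_BasisConj_eq[OF assms(2)] by (simp add: hPSigma_grp_def AutRF_def)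
qed

end
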